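(* Let $K$ be a field, let $\Gamma$ be a finite connected graph without loops, cycles or multiple edges, and let $Z(\Gamma)$ be the associated zigzag algebra over $K$. If the number of vertices satisfies $|\Gamma_0|>1$, then the first Hochschild cohomology group of $Z(\Gamma)$ has dimension one: $\dim_K HH^1(Z(\Gamma))=1$.
   Context: $\Gamma_0$ denotes the set of vertices of $\Gamma$. The zigzag algebra $Z(\Gamma)$ over $K$ is defined as follows. Let $Q$ be the quiver with vertex set $Q_0=\Gamma_0$ and arrow set $Q_1$ consisting, for each edge of $\Gamma$ joining $i$ and $j$, of two arrows $\alpha^{ij}$ (from $i$ to $j$) and $\alpha^{ji}$ (from $j$ to $i$). Paths are multiplied from left to right: a path ending at $b$ times a path starting at $c$ is the concatenation if $b=c$ and $0$ otherwise. Then $Z(\Gamma)$ is the quotient of the path algebra $KQ$ by the ideal generated by the relations: (1) all paths of length three or greater are zero; (2) all paths of length two that are not cycles are zero; (3) all length-two cycles based at the same vertex are equal. For a $K$-algebra $A$, $HH^1(A)=HH^1(A,A)$ is the first Hochschild cohomology group of $A$ with coefficients in $A$, which is isomorphic to the quotient of the space of $K$-linear derivations of $A$ by the subspace of inner derivations $a\mapsto [x,a]=xa-ax$ ($x\in A$). *)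

theory Defs
  imports "Jordan_Normal_Form.VS_Connect" "Graph_Theory.Graph_Theory"
    "HOL-Algebra.QuotRing"
begin

hide_const (open) Multiset.mult

section \<open>Quotients of modules and algebras\<close>

text \<open>
  A (not necessarily commutative) algebra over \<open>K\<close> is represented by a \<open>module\<close> record whose
  multiplicative part is the multiplication of the algebra.  For a plain module the
  multiplicative part carries no meaning.  The library's \<open>Quot\<close> forgets scalar
  multiplication; it is restored here.  \<open>I\<close> is a two-sided ideal if \<open>M\<close> is an algebra
  and a submodule if \<open>M\<close> is a plain module.
\<close>

definition quotient_module ::
  "('k, 'a, 'm) module_scheme \<Rightarrow> 'a set \<Rightarrow> ('k, 'a set) module"
  where "quotient_module M I =
    \<lparr>carrier = carrier (M Quot I), mult = mult (M Quot I), one = one (M Quot I),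
     zero = zero (M Quot I), add = add (M Quot I),
     smult = (\<lambda>k X. \<Union>x\<in>X. I +>\<^bsub>M\<^esub> (k \<odot>\<^bsub>M\<^esub> x))\<rparr>"


section \<open>Hochschild cohomology of an algebra with coefficients in itself\<close>

text \<open>
  The cochains of degree \<open>n\<close> are the \<open>K\<close>-multilinear maps from \<open>A\<^sup>n\<close> to \<open>A\<close>, equivalently the
  \<open>K\<close>-linear maps on the \<open>n\<close>-fold tensor power of \<open>A\<close>.  An element of \<open>A\<^sup>n\<close> is a list
  of length \<open>n\<close>.
\<close>

definition tuples :: "('a, 'm) ring_scheme \<Rightarrow> nat \<Rightarrow> 'a list set"
  where "tuples A n = {xs. length xs = n \<and> set xs \<subseteq> carrier A}"

definition hochschild_cochains ::
  "('k, 'l) ring_scheme \<Rightarrow> ('k, 'a, 'm) module_scheme \<Rightarrow> nat \<Rightarrow> ('a list \<Rightarrow> 'a) set"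
  where "hochschild_cochains K A n =
    {f \<in> tuples A n \<rightarrow>\<^sub>E carrier A.
      \<forall>xs ys. \<forall>x\<in>carrier A. \<forall>y\<in>carrier A. \<forall>k\<in>carrier K.
        set xs \<subseteq> carrier A \<and> set ys \<subseteq> carrier A \<and> length xs + 1 + length ys = n \<longrightarrow>
          f (xs @ (x \<oplus>\<^bsub>A\<^esub> y) # ys) = f (xs @ x # ys) \<oplus>\<^bsub>A\<^esub> f (xs @ y # ys) \<and>
          f (xs @ (k \<odot>\<^bsub>A\<^esub> x) # ys) = k \<odot>\<^bsub>A\<^esub> f (xs @ x # ys)}"

definition hochschild_module ::
  "('k, 'l) ring_scheme \<Rightarrow> ('k, 'a, 'm) module_scheme \<Rightarrow> nat \<Rightarrow> ('k, 'a list \<Rightarrow> 'a) module"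
  where "hochschild_module K A n =
    \<lparr>carrier = hochschild_cochains K A n, mult = undefined, one = undefined,
     zero = (\<lambda>xs\<in>tuples A n. \<zero>\<^bsub>A\<^esub>),
     add = (\<lambda>f g. \<lambda>xs\<in>tuples A n. f xs \<oplus>\<^bsub>A\<^esub> g xs),
     smult = (\<lambda>k f. \<lambda>xs\<in>tuples A n. k \<odot>\<^bsub>A\<^esub> f xs)\<rparr>"

definition signed :: "('a, 'm) ring_scheme \<Rightarrow> nat \<Rightarrow> 'a \<Rightarrow> 'a"
  where "signed A i x = (if even i then x else \<ominus>\<^bsub>A\<^esub> x)"

text \<open>
  The Hochschild differential from degree \<open>n\<close> to degree \<open>n + 1\<close>.  The list
  \<open>xs = [a\<^sub>1, \<dots>, a\<^sub>n\<^sub>+\<^sub>1]\<close> is indexed from \<open>0\<close>, so the inner summand with index \<open>i\<close> is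
  \<open>(-1)\<^sup>i f [a\<^sub>1, \<dots>, a\<^sub>i a\<^sub>i\<^sub>+\<^sub>1, \<dots>, a\<^sub>n\<^sub>+\<^sub>1]\<close>.
\<close>

definition hochschild_diff ::
  "('k, 'a, 'm) module_scheme \<Rightarrow> nat \<Rightarrow> ('a list \<Rightarrow> 'a) \<Rightarrow> 'a list \<Rightarrow> 'a"
  where "hochschild_diff A n f =
    (\<lambda>xs\<in>tuples A (Suc n).
      hd xs \<otimes>\<^bsub>A\<^esub> f (tl xs)
      \<oplus>\<^bsub>A\<^esub> (\<Oplus>\<^bsub>A\<^esub>i\<in>{1..n}.
            signed A i (f (take (i - 1) xs @ (xs ! (i - 1) \<otimes>\<^bsub>A\<^esub> xs ! i) # drop (i + 1) xs)))
      \<oplus>\<^bsub>A\<^esub> signed A (n + 1) (f (butlast xs) \<otimes>\<^bsub>A\<^esub> last xs))"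

definition hochschild_cocycles ::
  "('k, 'l) ring_scheme \<Rightarrow> ('k, 'a, 'm) module_scheme \<Rightarrow> nat \<Rightarrow> ('a list \<Rightarrow> 'a) set"
  where "hochschild_cocycles K A n =
    {f \<in> hochschild_cochains K A n.
       hochschild_diff A n f = \<zero>\<^bsub>hochschild_module K A (Suc n)\<^esub>}"

primrec hochschild_coboundaries ::
  "('k, 'l) ring_scheme \<Rightarrow> ('k, 'a, 'm) module_scheme \<Rightarrow> nat \<Rightarrow> ('a list \<Rightarrow> 'a) set"
  where
    "hochschild_coboundaries K A 0 = {\<zero>\<^bsub>hochschild_module K A 0\<^esub>}"
  | "hochschild_coboundaries K A (Suc n) = hochschild_diff A n ` hochschild_cochains K A n"

definition hochschild_cohomology ::
  "('k, 'l) ring_scheme \<Rightarrow> ('k, 'a, 'm) module_scheme \<Rightarrow> nat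
    \<Rightarrow> ('k, ('a list \<Rightarrow> 'a) set) module"
  where "hochschild_cohomology K A n =
    quotient_module
      ((hochschild_module K A n)\<lparr>carrier := hochschild_cocycles K A n\<rparr>)
      (hochschild_coboundaries K A n)"

text \<open>
  In degree one the cocycle condition is the Leibniz rule, and the coboundaries are the
  commutators with a fixed element.
\<close>

lemma hochschild_diff_0:
  assumes "ring A" and "x \<in> carrier A" and "f [] \<in> carrier A"
  shows "hochschild_diff A 0 f [x] = x \<otimes>\<^bsub>A\<^esub> f [] \<ominus>\<^bsub>A\<^esub> f [] \<otimes>\<^bsub>A\<^esub> x"
proof -
  interpret ring A by fact
  show ?thesis using assms
    by (simp add: hochschild_diff_def tuples_def signed_def a_minus_def)
qed

lemma hochschild_diff_1:
  assumes "ring A" and "x \<in> carrier A" and "y \<in> carrier A"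
    and f: "\<And>z. z \<in> carrier A \<Longrightarrow> f [z] \<in> carrier A"
  shows "hochschild_diff A 1 f [x, y] =
    x \<otimes>\<^bsub>A\<^esub> f [y] \<ominus>\<^bsub>A\<^esub> f [x \<otimes>\<^bsub>A\<^esub> y] \<oplus>\<^bsub>A\<^esub> f [x] \<otimes>\<^bsub>A\<^esub> y"
proof -
  interpret ring A by fact
  show ?thesis using assms
    by (simp add: hochschild_diff_def tuples_def signed_def a_minus_def)
qed


section \<open>Path algebras of quivers\<close>

text \<open>
  A quiver is a \<open>pre_digraph\<close>.  The path with initial vertex \<open>u\<close> traversing the arrows
  \<open>p\<close> from left to right is the pair \<open>(u, p)\<close>; the trivial path at \<open>u\<close> is \<open>(u, [])\<close>.
\<close>

definition quiver_paths :: "('v, 'e) pre_digraph \<Rightarrow> ('v \<times> 'e list) set"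
  where "quiver_paths Q = {(u, p). \<exists>v. pre_digraph.awalk Q u p v}"

text \<open>
  Elements of the path algebra are finitely supported functions on the paths.  The coefficient
  of a product at a path is the convolution sum over all ways of cutting this path in two,
  which is the bilinear extension of concatenation from left to right.  The unit
  is the sum of the trivial paths (for finitely many vertices).
\<close>

definition path_algebra ::
  "('v, 'e) pre_digraph \<Rightarrow> ('k::field, 'v \<times> 'e list \<Rightarrow> 'k) module"
  where "path_algebra Q =
    \<lparr>carrier = {f. finite {x. f x \<noteq> 0} \<and> {x. f x \<noteq> 0} \<subseteq> quiver_paths Q},
     mult = (\<lambda>f g. \<lambda>(u, p). \<Sum>i\<le>length p.
       f (u, take i p) * g (pre_digraph.awlast Q u (take i p), drop i p)),
     one = (\<lambda>(u, p). if u \<in> verts Q \<and> p = [] then 1 else 0),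
     zero = (\<lambda>_. 0),
     add = (\<lambda>f g x. f x + g x),
     smult = (\<lambda>c f x. c * f x)\<rparr>"

text \<open>In particular, generated ideals in a path algebra of a finite quiver are meaningful.\<close>

lemma path_algebra_ring:
  assumes "fin_digraph Q"
  shows "ring (path_algebra Q :: ('k::field, 'v \<times> 'e list \<Rightarrow> 'k) module)" (is "ring ?R")
proof -
  interpret fin_digraph Q by fact
  define supp :: "('v \<times> 'e list \<Rightarrow> 'k) \<Rightarrow> _" where "supp f = {x. f x \<noteq> 0}" for f
  have carr: "f \<in> carrier ?R \<longleftrightarrow> finite (supp f) \<and> supp f \<subseteq> quiver_paths Q" for f
    by (simp add: path_algebra_def supp_def)
  have path: "(u, p) \<in> quiver_paths Q \<longleftrightarrow> awalk u p (awlast u p)" for u p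
    unfolding quiver_paths_def by auto
  have add_cl: "f \<oplus>\<^bsub>?R\<^esub> g \<in> carrier ?R" if "f \<in> carrier ?R" "g \<in> carrier ?R" for f g
  proof -
    have "supp (f \<oplus>\<^bsub>?R\<^esub> g) \<subseteq> supp f \<union> supp g" by (auto simp: supp_def path_algebra_def)
    then show ?thesis using that unfolding carr by (meson finite_UnI finite_subset le_sup_iff subset_trans)
  qed
  have mult_cl: "f \<otimes>\<^bsub>?R\<^esub> g \<in> carrier ?R" if "f \<in> carrier ?R" "g \<in> carrier ?R" for f g
  proof -
    have ex: "\<exists>p1 p2. p = p1 @ p2 \<and> (u, p1) \<in> supp f \<and> (awlast u p1, p2) \<in> supp g"
      if "(u, p) \<in> supp (f \<otimes>\<^bsub>?R\<^esub> g)" for u p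
    proof -
      from that obtain i where "f (u, take i p) * g (awlast u (take i p), drop i p) \<noteq> 0"
        by (auto simp: supp_def path_algebra_def elim: sum.not_neutral_contains_not_neutral)
      then show ?thesis
        by (intro exI[of _ "take i p"] exI[of _ "drop i p"]) (auto simp: supp_def)
    qed
    have "supp (f \<otimes>\<^bsub>?R\<^esub> g) \<subseteq> (\<lambda>((u, p), (v, q)). (u, p @ q)) ` (supp f \<times> supp g)"
    proof safe
      fix u p assume "(u, p) \<in> supp (f \<otimes>\<^bsub>?R\<^esub> g)"
      from ex[OF this] obtain p1 p2 where "p = p1 @ p2" "(u, p1) \<in> supp f" "(awlast u p1, p2) \<in> supp g"
        by blast
      then show "(u, p) \<in> (\<lambda>((u, p), (v, q)). (u, p @ q)) ` (supp f \<times> supp g)"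
        by (intro image_eqI[of _ _ "((u, p1), (awlast u p1, p2))"]) auto
    qed
    moreover have "supp (f \<otimes>\<^bsub>?R\<^esub> g) \<subseteq> quiver_paths Q"
    proof safe
      fix u p assume "(u, p) \<in> supp (f \<otimes>\<^bsub>?R\<^esub> g)"
      from ex[OF this] obtain p1 p2 where "p = p1 @ p2" "(u, p1) \<in> supp f" "(awlast u p1, p2) \<in> supp g"
        by blast
      then show "(u, p) \<in> quiver_paths Q"
        using that unfolding carr by (metis awalk_append_iff awlast_append path subsetD)
    qed
    ultimately show ?thesis using that unfolding carr by (meson finite_SigmaI finite_imageI finite_subset)
  qed
  have one_cl: "\<one>\<^bsub>?R\<^esub> \<in> carrier ?R"
  proof -
    have "supp \<one>\<^bsub>?R\<^esub> = (\<lambda>u. (u, [])) ` verts Q" by (auto simp: supp_def path_algebra_def split: if_splits)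
    then show ?thesis unfolding carr by (auto simp: path awalk_Nil_iff)
  qed
  have assoc: "(f \<otimes>\<^bsub>?R\<^esub> g) \<otimes>\<^bsub>?R\<^esub> h = f \<otimes>\<^bsub>?R\<^esub> (g \<otimes>\<^bsub>?R\<^esub> h)" for f g h
  proof (rule ext, clarify)
    fix u :: 'v and p :: "'e list"
    let ?n = "length p"
    let ?w = "\<lambda>j. awlast u (take j p)"
    let ?T = "\<lambda>j k. f (u, take j p) * g (?w j, take k (drop j p)) * h (?w (j + k), drop (j + k) p)"
    have "((f \<otimes>\<^bsub>?R\<^esub> g) \<otimes>\<^bsub>?R\<^esub> h) (u, p) = (\<Sum>i\<le>?n. \<Sum>j\<le>i. ?T j (i - j))"
      by (auto simp: path_algebra_def sum_distrib_right drop_take min_def intro!: sum.cong)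
    also have "\<dots> = (\<Sum>(j, k)\<in>{(j, k). j + k \<le> ?n}. ?T j k)" by (rule sum.triangle_reindex_eq[symmetric])
    also have "{(j, k). j + k \<le> ?n} = (SIGMA j:{..?n}. {..?n - j})" by auto
    also have "(\<Sum>(j, k)\<in>\<dots>. ?T j k) = (\<Sum>j\<le>?n. \<Sum>k\<le>?n - j. ?T j k)" by (simp add: sum.Sigma)
    also have "\<dots> = (f \<otimes>\<^bsub>?R\<^esub> (g \<otimes>\<^bsub>?R\<^esub> h)) (u, p)"
      by (auto simp: path_algebra_def sum_distrib_left take_add awlast_append mult.assoc add.commute intro!: sum.cong)
    finally show "((f \<otimes>\<^bsub>?R\<^esub> g) \<otimes>\<^bsub>?R\<^esub> h) (u, p) = (f \<otimes>\<^bsub>?R\<^esub> (g \<otimes>\<^bsub>?R\<^esub> h)) (u, p)" .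
  qed
  have vert: "u \<in> verts Q \<and> awlast u (take i p) \<in> verts Q" if "f \<in> carrier ?R" "f (u, p) \<noteq> 0" for f u p i
  proof -
    have "awalk u p (awlast u p)" using that unfolding carr supp_def by (auto simp flip: path)
    then have "awalk u (take i p @ drop i p) (awlast u p)" by simp
    then show ?thesis unfolding awalk_append_iff by blast
  qed
  have l_one: "\<one>\<^bsub>?R\<^esub> \<otimes>\<^bsub>?R\<^esub> f = f" if f: "f \<in> carrier ?R" for f
  proof (rule ext, clarify)
    fix u :: 'v and p :: "'e list"
    have "(\<one>\<^bsub>?R\<^esub> \<otimes>\<^bsub>?R\<^esub> f) (u, p)
        = (\<Sum>i\<le>length p. (if u \<in> verts Q \<and> take i p = [] then 1 else 0) * f (awlast u (take i p), drop i p))"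
      by (simp add: path_algebra_def)
    also have "\<dots> = (\<Sum>i\<le>length p. if i = 0 then (if u \<in> verts Q then f (u, p) else 0) else 0)"
      by (rule sum.cong) auto
    finally have "(\<one>\<^bsub>?R\<^esub> \<otimes>\<^bsub>?R\<^esub> f) (u, p)
        = (\<Sum>i\<le>length p. if i = 0 then (if u \<in> verts Q then f (u, p) else 0) else 0)" .
    then show "(\<one>\<^bsub>?R\<^esub> \<otimes>\<^bsub>?R\<^esub> f) (u, p) = f (u, p)" using vert[OF f] by (auto simp: sum.delta)
  qed
  have r_one: "f \<otimes>\<^bsub>?R\<^esub> \<one>\<^bsub>?R\<^esub> = f" if f: "f \<in> carrier ?R" for f
  proof (rule ext, clarify)
    fix u :: 'v and p :: "'e list"
    have "(f \<otimes>\<^bsub>?R\<^esub> \<one>\<^bsub>?R\<^esub>) (u, p)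
        = (\<Sum>i\<le>length p. f (u, take i p) * (if awlast u (take i p) \<in> verts Q \<and> drop i p = [] then 1 else 0))"
      by (simp add: path_algebra_def)
    also have "\<dots> = (\<Sum>i\<le>length p. if i = length p then (if awlast u p \<in> verts Q then f (u, p) else 0) else 0)"
      by (rule sum.cong) auto
    finally have "(f \<otimes>\<^bsub>?R\<^esub> \<one>\<^bsub>?R\<^esub>) (u, p)
        = (\<Sum>i\<le>length p. if i = length p then (if awlast u p \<in> verts Q then f (u, p) else 0) else 0)" .
    then show "(f \<otimes>\<^bsub>?R\<^esub> \<one>\<^bsub>?R\<^esub>) (u, p) = f (u, p)" using vert[OF f, of u p "length p"] by (auto simp: sum.delta)
  qed
  show ?thesis
  proof (intro ringI abelian_groupI Group.monoidI)
    fix f assume f: "f \<in> carrier ?R"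
    then have "(\<lambda>x. - f x) \<in> carrier ?R" by (simp add: path_algebra_def)
    then show "\<exists>g\<in>carrier ?R. g \<oplus>\<^bsub>?R\<^esub> f = \<zero>\<^bsub>?R\<^esub>"
      by (rule rev_bexI) (simp add: path_algebra_def)
  qed (simp_all add: add_cl mult_cl one_cl assoc l_one r_one,
       auto simp: path_algebra_def algebra_simps sum.distrib intro!: ext)
qed

definition path_elem :: "'v \<times> 'e list \<Rightarrow> 'v \<times> 'e list \<Rightarrow> 'k::field"
  where "path_elem x = (\<lambda>y. if y = x then 1 else 0)"


section \<open>Zigzag algebras\<close>

text \<open>
  Following the library, an undirected graph \<open>\<Gamma>\<close> without loops and multiple edges is a
  symmetric digraph (locale \<open>graph\<close>): every edge joining \<open>i\<close> and \<open>j\<close> is a pair of opposite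
  arcs.  This digraph is the double quiver \<open>Q\<close> of \<open>\<Gamma>\<close>.

  As going back and forth along one edge is a directed cycle of length two, the library's
  \<open>forest\<close> does not express that \<open>\<Gamma>\<close> has no cycles.  In a graph without loops and multiple
  edges the cycles are the closed walks of length at least three without repeated vertices.
\<close>

definition acyclic_graph :: "('v, 'e) pre_digraph \<Rightarrow> bool"
  where "acyclic_graph \<Gamma> \<longleftrightarrow> \<not> (\<exists>p. pre_digraph.cycle \<Gamma> p \<and> 3 \<le> length p)"

definition zigzag_relations :: "('v, 'e) pre_digraph \<Rightarrow> ('v \<times> 'e list \<Rightarrow> 'k::field) set"
  where "zigzag_relations \<Gamma> =
    {path_elem (u, p) | u p v. pre_digraph.awalk \<Gamma> u p v \<and> 3 \<le> length p}
    \<union> {path_elem (u, p) | u p v. pre_digraph.awalk \<Gamma> u p v \<and> length p = 2 \<and> v \<noteq> u}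
    \<union> {path_elem (u, p) \<ominus>\<^bsub>path_algebra \<Gamma>\<^esub> path_elem (u, q) | u p q.
         pre_digraph.awalk \<Gamma> u p u \<and> length p = 2 \<and>
         pre_digraph.awalk \<Gamma> u q u \<and> length q = 2}"

definition zigzag_algebra ::
  "('v, 'e) pre_digraph \<Rightarrow> ('k::field, ('v \<times> 'e list \<Rightarrow> 'k) set) module"
  where "zigzag_algebra \<Gamma> =
    quotient_module (path_algebra \<Gamma>) (Idl\<^bsub>path_algebra \<Gamma>\<^esub> (zigzag_relations \<Gamma>))"

end

theory Submission
  imports Defs
begin

text \<open>
  Write \<open>e\<^sub>u\<close>, \<open>a\<close>, \<open>l\<^sub>u\<close> for the vertex idempotents, the arrows and the 2-cycles, which form a basis
  of the zigzag algebra.  Modulo an inner derivation, a derivation \<open>D\<close> kills all \<open>e\<^sub>u\<close>, and since there are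
  no loops and no multiple edges this forces \<open>D(a) = c\<^sub>a a\<close> for every arrow \<open>a\<close>.  With \<open>a'\<close> opposite
  to \<open>a\<close>, the relation \<open>a a' = l\<^sub>u\<close> gives \<open>D(l\<^sub>u) = (c\<^sub>a + c\<^sub>a\<^sub>') l\<^sub>u\<close>, so the scalar \<open>s = c\<^sub>a + c\<^sub>a\<^sub>'\<close> is the same
  for all arrows by connectedness.  If \<open>s = 0\<close>, then \<open>c\<close> is antisymmetric, hence on a tree it is the
  gradient of a function \<open>p\<close> on the vertices, and \<open>D\<close> is the commutator with \<open>\<Sum>\<^sub>u p\<^sub>u e\<^sub>u\<close>.  Thus the
  inner derivations are the kernel of the functional \<open>D \<mapsto> s\<close>, the coefficient of \<open>l\<^sub>r\<close> in \<open>D(l\<^sub>r)\<close> for a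
  fixed vertex \<open>r\<close>.  It is onto: orient the edges and let \<open>D\<close> scale the positively oriented arrows and
  all \<open>l\<^sub>u\<close> by one and the remaining basis elements by zero; unlike the Euler derivation, this works in
  characteristic 2.
\<close>

section \<open>Quotient modules\<close>

text \<open>Every element of \<open>Q\<close> has the form \<open>F s\<close>, so each axiom for
  \<open>Q\<close> is the image of the axiom for \<open>S\<close>. This yields the module axioms for
  quotients without computing with cosets.\<close>

lemma module_transport:
  assumes "Module.module K S" and bij: "bij_betw F (carrier S) (carrier Q)"
    and zero: "F \<zero>\<^bsub>S\<^esub> = \<zero>\<^bsub>Q\<^esub>"
    and add: "\<And>s t. s \<in> carrier S \<Longrightarrow> t \<in> carrier S \<Longrightarrow> F (s \<oplus>\<^bsub>S\<^esub> t) = F s \<oplus>\<^bsub>Q\<^esub> F t"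
    and smult: "\<And>k s. k \<in> carrier K \<Longrightarrow> s \<in> carrier S \<Longrightarrow> F (k \<odot>\<^bsub>S\<^esub> s) = k \<odot>\<^bsub>Q\<^esub> F s"
  shows "Module.module K Q"
proof -
  interpret S: Module.module K S by fact
  have Q: "carrier Q = F ` carrier S" using bij by (simp add: bij_betw_def)
  show ?thesis
  proof (rule moduleI)
    show "abelian_group Q"
    proof (rule abelian_groupI)
      fix x assume "x \<in> carrier Q"
      then obtain s where s: "s \<in> carrier S" "x = F s" by (auto simp: Q)
      then have "F (\<ominus>\<^bsub>S\<^esub> s) \<oplus>\<^bsub>Q\<^esub> x = \<zero>\<^bsub>Q\<^esub>"
        by (simp add: S.l_neg zero flip: add)
      then show "\<exists>y\<in>carrier Q. y \<oplus>\<^bsub>Q\<^esub> x = \<zero>\<^bsub>Q\<^esub>" using s by (auto simp: Q)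
    qed (auto simp: Q S.a_ac simp flip: zero add)
  qed (auto simp: Q S.smult_l_distr S.smult_r_distr S.smult_assoc1 S.R.cring_axioms
        simp flip: zero add smult)
qed

text \<open>Both quotients that occur, cohomology and the zigzag algebra, are quotients by the
  kernel of an explicit epimorphism \<open>h\<close>. The isomorphism theorem then identifies them
  with \<open>S\<close>.\<close>

locale module_epimorphism = M: Module.module K M + S: Module.module K S
  for K :: "('k, 'l) ring_scheme" (structure) and M :: "('k, 'a, 'm) module_scheme"
    and S :: "('k, 'b, 'n) module_scheme" +
  fixes h :: "'a \<Rightarrow> 'b"
  assumes image: "h ` carrier M = carrier S"
    and hom_add: "\<And>x y. x \<in> carrier M \<Longrightarrow> y \<in> carrier M \<Longrightarrow> h (x \<oplus>\<^bsub>M\<^esub> y) = h x \<oplus>\<^bsub>S\<^esub> h y"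
    and hom_smult: "\<And>k x. k \<in> carrier K \<Longrightarrow> x \<in> carrier M \<Longrightarrow> h (k \<odot>\<^bsub>M\<^esub> x) = k \<odot>\<^bsub>S\<^esub> h x"
begin

text \<open>The fibres are the cosets of the kernel \<open>fibre \<zero>\<close>, so
  \<open>fibre\<close> is the inverse of the isomorphism from \<open>Q\<close> to \<open>S\<close>
  induced by \<open>h\<close>.\<close>

definition fibre :: "'b \<Rightarrow> 'a set"
  where "fibre s = {x \<in> carrier M. h x = s}"

abbreviation Q :: "('k, 'a set) module"
  where "Q \<equiv> quotient_module M (fibre \<zero>\<^bsub>S\<^esub>)"

lemma hom_closed [simp]: "x \<in> carrier M \<Longrightarrow> h x \<in> carrier S"
  using image by blast

lemma fibreE:
  assumes "s \<in> carrier S" obtains x where "x \<in> carrier M" "h x = s"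
  using assms that unfolding image[symmetric] by auto

lemma hom_zero: "h \<zero>\<^bsub>M\<^esub> = \<zero>\<^bsub>S\<^esub>"
proof -
  have "h \<zero>\<^bsub>M\<^esub> \<oplus>\<^bsub>S\<^esub> h \<zero>\<^bsub>M\<^esub> = h \<zero>\<^bsub>M\<^esub>" 
    using hom_add[OF M.M.zero_closed M.M.zero_closed] unfolding M.M.r_zero[OF M.M.zero_closed] ..
  then show ?thesis using S.M.add.r_cancel_one[OF hom_closed hom_closed] by blast
qed

lemma hom_minus: "x \<in> carrier M \<Longrightarrow> h (\<ominus>\<^bsub>M\<^esub> x) = \<ominus>\<^bsub>S\<^esub> h x"
  using hom_add[of "\<ominus>\<^bsub>M\<^esub> x" x] by (simp add: M.M.l_neg hom_zero S.M.minus_equality)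

lemma rcoset:
  assumes "x \<in> carrier M" shows "fibre \<zero>\<^bsub>S\<^esub> +>\<^bsub>M\<^esub> x = fibre (h x)"
proof (intro equalityI subsetI)
  fix y assume "y \<in> fibre (h x)"
  then have y: "y \<in> carrier M" "h y = h x" by (auto simp: fibre_def)
  then have "y \<oplus>\<^bsub>M\<^esub> \<ominus>\<^bsub>M\<^esub> x \<in> fibre \<zero>\<^bsub>S\<^esub>"
    using assms by (simp add: fibre_def hom_add hom_minus S.M.r_neg)
  moreover have "y = y \<oplus>\<^bsub>M\<^esub> \<ominus>\<^bsub>M\<^esub> x \<oplus>\<^bsub>M\<^esub> x" using y assms by (simp add: M.M.a_assoc M.M.l_neg)
  ultimately show "y \<in> fibre \<zero>\<^bsub>S\<^esub> +>\<^bsub>M\<^esub> x" by (auto simp: a_r_coset_def')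
qed (use assms in \<open>auto simp: a_r_coset_def' fibre_def hom_add\<close>)

lemma fibre_bij: "bij_betw fibre (carrier S) (carrier Q)"
proof (rule bij_betw_imageI)
  show "inj_on fibre (carrier S)"
  proof (rule inj_onI)
    fix s t assume s: "s \<in> carrier S" and eq: "fibre s = fibre t"
    obtain x where "x \<in> carrier M" "h x = s" using s by (rule fibreE)
    then have "x \<in> fibre t" unfolding eq[symmetric] by (simp add: fibre_def)
    then show "s = t" using \<open>h x = s\<close> by (simp add: fibre_def)
  qed
  show "fibre ` carrier S = carrier Q"
    unfolding image[symmetric]
    by (auto simp: quotient_module_def FactRing_def A_RCOSETS_def' rcoset)
qed

lemma fibre_zero: "fibre \<zero>\<^bsub>S\<^esub> = \<zero>\<^bsub>Q\<^esub>"
  by (simp add: quotient_module_def FactRing_def)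

lemma fibre_add:
  assumes "s \<in> carrier S" "t \<in> carrier S"
  shows "fibre (s \<oplus>\<^bsub>S\<^esub> t) = fibre s \<oplus>\<^bsub>Q\<^esub> fibre t"
proof (intro equalityI subsetI)
  fix z assume "z \<in> fibre (s \<oplus>\<^bsub>S\<^esub> t)"
  then have z: "z \<in> carrier M" "h z = s \<oplus>\<^bsub>S\<^esub> t" by (auto simp: fibre_def)
  obtain x where x: "x \<in> carrier M" "h x = s" using assms(1) by (rule fibreE)
  \<comment> \<open>Coset addition is elementwise, so z must be split into two representatives: a
    point x over \<open>s\<close>, and the difference, which lies over \<open>t\<close>.\<close>
  have "\<ominus>\<^bsub>M\<^esub> x \<oplus>\<^bsub>M\<^esub> z \<in> fibre t"
    using x z assms by (simp add: fibre_def hom_add hom_minus S.M.l_neg flip: S.M.a_assoc)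
  moreover have "z = x \<oplus>\<^bsub>M\<^esub> (\<ominus>\<^bsub>M\<^esub> x \<oplus>\<^bsub>M\<^esub> z)"
    using x z by (simp add: M.M.r_neg flip: M.M.a_assoc)
  moreover have "x \<in> fibre s" using x by (simp add: fibre_def)
  ultimately show "z \<in> fibre s \<oplus>\<^bsub>Q\<^esub> fibre t"
    unfolding quotient_module_def FactRing_def by (auto simp: set_add_def')
qed (use assms in \<open>auto simp: quotient_module_def FactRing_def set_add_def' fibre_def hom_add\<close>)

text \<open>The scalar multiple in the quotient is a union over all representatives of a coset. The
  cosets in this union coincide, and surjectivity of \<open>h\<close> makes it nonempty.\<close>

lemma fibre_smult:
  assumes "k \<in> carrier K" "s \<in> carrier S"
  shows "fibre (k \<odot>\<^bsub>S\<^esub> s) = k \<odot>\<^bsub>Q\<^esub> fibre s"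
proof -
  obtain x where "x \<in> carrier M" "h x = s" using assms(2) by (rule fibreE)
  moreover have "fibre \<zero>\<^bsub>S\<^esub> +>\<^bsub>M\<^esub> (k \<odot>\<^bsub>M\<^esub> y) = fibre (k \<odot>\<^bsub>S\<^esub> s)" if "y \<in> fibre s" for y
    using that assms by (auto simp: fibre_def rcoset[unfolded fibre_def] hom_smult)
  ultimately show ?thesis by (auto simp: quotient_module_def fibre_def)
qed

text \<open>Multiplicativity is a premise here rather than part of the locale, because the
  multiplication of a plain module such as the cocycles carries no meaning.\<close>

lemma fibre_mult:
  assumes "s \<in> carrier S" "t \<in> carrier S"
    and closed: "\<And>x y. x \<in> carrier M \<Longrightarrow> y \<in> carrier M \<Longrightarrow> x \<otimes>\<^bsub>M\<^esub> y \<in> carrier M"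
    and hom: "\<And>x y. x \<in> carrier M \<Longrightarrow> y \<in> carrier M \<Longrightarrow> h (x \<otimes>\<^bsub>M\<^esub> y) = h x \<otimes>\<^bsub>S\<^esub> h y"
  shows "fibre (s \<otimes>\<^bsub>S\<^esub> t) = fibre s \<otimes>\<^bsub>Q\<^esub> fibre t"
proof -
  obtain x where "x \<in> carrier M" "h x = s" using assms(1) by (rule fibreE)
  moreover obtain y where "y \<in> carrier M" "h y = t" using assms(2) by (rule fibreE)
  moreover have "fibre \<zero>\<^bsub>S\<^esub> +>\<^bsub>M\<^esub> (x \<otimes>\<^bsub>M\<^esub> y) = fibre (s \<otimes>\<^bsub>S\<^esub> t)"
    if "x \<in> fibre s" "y \<in> fibre t" for x y
    using that closed hom by (auto simp: fibre_def rcoset[unfolded fibre_def])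
  ultimately show ?thesis
    by (auto simp: quotient_module_def FactRing_def rcoset_mult_def fibre_def)
qed

lemma module_Q: "Module.module K Q"
  by (rule module_transport[OF S.module_axioms fibre_bij fibre_zero fibre_add fibre_smult])

end

section \<open>One-dimensional quotients by the kernel of a functional\<close>

abbreviation (input) base_module :: "('k::field, 'k) module"
  where "base_module \<equiv> \<lparr>carrier = UNIV, mult = (*), one = 1, zero = 0, add = (+), smult = (*)\<rparr>"

lemma module_base: "Module.module (class_ring :: 'k::field ring) base_module"
proof (rule moduleI)
  show "abelian_group (base_module :: ('k, 'k) module)"
    by (rule abelian_groupI) (auto simp: algebra_simps intro: exI[of _ "- x" for x :: 'k] left_minus)
  show "cring (class_ring :: 'k ring)" by (rule class_cring.cring_axioms)
qed (simp_all add: distrib_left distrib_right mult.assoc)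

text \<open>Since \<phi> takes the value k at k times \<open>m\<close>, it is onto, and the quotient
  by its kernel is isomorphic to the field.\<close>

lemma quotient_by_functional_dim_one:
  fixes M :: "('k::field, 'a, 'm) module_scheme" and \<phi> :: "'a \<Rightarrow> 'k"
  assumes "Module.module class_ring M"
    and add: "\<And>x y. x \<in> carrier M \<Longrightarrow> y \<in> carrier M \<Longrightarrow> \<phi> (x \<oplus>\<^bsub>M\<^esub> y) = \<phi> x + \<phi> y"
    and smult: "\<And>k x. x \<in> carrier M \<Longrightarrow> \<phi> (k \<odot>\<^bsub>M\<^esub> x) = k * \<phi> x"
    and m: "m \<in> carrier M" "\<phi> m = 1"
    and N: "N = {x \<in> carrier M. \<phi> x = 0}"
  defines "H \<equiv> quotient_module M N"
  shows "vectorspace class_ring H \<and> vectorspace.fin_dim class_ring H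
    \<and> vectorspace.dim class_ring H = 1"
proof -
  interpret M: Module.module "class_ring :: 'k ring" M by fact
  have "\<phi> ` carrier M = UNIV"
  proof (intro equalityI subsetI)
    show "k \<in> \<phi> ` carrier M" for k
      using m smult by (intro image_eqI[of _ _ "k \<odot>\<^bsub>M\<^esub> m"]) simp_all
  qed simp
  then interpret E: module_epimorphism "class_ring :: 'k ring" M base_module \<phi>
    by (intro module_epimorphism.intro module_epimorphism_axioms.intro)
      (simp_all add: M.module_axioms module_base add smult)
  have H: "H = E.Q" unfolding H_def N E.fibre_def by simp
  have vs: "vectorspace class_ring H"
    unfolding vectorspace_def H using E.module_Q class_field by blast
  interpret V: vectorspace "class_ring :: 'k ring" H by (rule vs)
  \<comment> \<open>The coset on which \<phi> is one. The coset with value c is c times it, so it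
    spans the quotient alone.\<close>
  let ?v = "E.fibre 1"
  have v: "?v \<in> carrier H"
    unfolding H using E.fibre_bij by (auto simp: bij_betw_def)
  have nz: "?v \<noteq> \<zero>\<^bsub>H\<^esub>"
    unfolding H E.fibre_zero[symmetric]
    using inj_onD[OF bij_betw_imp_inj_on[OF E.fibre_bij], of 1 0] by auto
  have gen: "V.span {?v} = carrier H"
  proof
    show "carrier H \<subseteq> V.span {?v}"
    proof
      fix X assume "X \<in> carrier H"
      then obtain c where "X = E.fibre c" unfolding H using E.fibre_bij by (auto simp: bij_betw_def)
      then have "X = c \<odot>\<^bsub>H\<^esub> ?v" unfolding H using E.fibre_smult[of c 1] by simp
      moreover have "c \<odot>\<^bsub>H\<^esub> ?v \<in> V.span {?v}"
        using V.span_is_submodule[of "{?v}"] V.in_own_span[of "{?v}"] v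
        by (auto intro: submodule.smult_closed)
      ultimately show "X \<in> V.span {?v}" by simp
    qed
  qed (use v V.span_is_subset2[of "{?v}"] in auto)
  have "V.fin_dim" unfolding V.fin_dim_def using gen v by (intro exI[of _ "{?v}"]) auto
  with vs V.dim1I[OF gen nz v] show ?thesis by blast
qed

section \<open>First Hochschild cohomology and derivations\<close>

locale k_algebra = Module.module "class_ring :: 'k::field ring" A + A?: ring A
  for A :: "('k::field, 'a, 'm) module_scheme" (structure) +
  assumes smult_mult: "x \<in> carrier A \<Longrightarrow> y \<in> carrier A \<Longrightarrow> (k \<odot> x) \<otimes> y = k \<odot> (x \<otimes> y)"
    and mult_smult: "x \<in> carrier A \<Longrightarrow> y \<in> carrier A \<Longrightarrow> x \<otimes> (k \<odot> y) = k \<odot> (x \<otimes> y)"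

definition is_derivation :: "('k, 'a, 'm) module_scheme \<Rightarrow> ('a \<Rightarrow> 'a) \<Rightarrow> bool"
  where "is_derivation A D \<longleftrightarrow> D \<in> carrier A \<rightarrow> carrier A \<and>
    (\<forall>x\<in>carrier A. \<forall>y\<in>carrier A. D (x \<oplus>\<^bsub>A\<^esub> y) = D x \<oplus>\<^bsub>A\<^esub> D y) \<and>
    (\<forall>k. \<forall>x\<in>carrier A. D (k \<odot>\<^bsub>A\<^esub> x) = k \<odot>\<^bsub>A\<^esub> D x) \<and>
    (\<forall>x\<in>carrier A. \<forall>y\<in>carrier A. D (x \<otimes>\<^bsub>A\<^esub> y) = x \<otimes>\<^bsub>A\<^esub> D y \<oplus>\<^bsub>A\<^esub> D x \<otimes>\<^bsub>A\<^esub> y)"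

text \<open>The sign follows the Hochschild differential in degree zero. Replacing \<open>w\<close>
  by its negative gives the commutator [w, x], so both conventions have the same inner
  derivations.\<close>

definition is_inner :: "('k, 'a, 'm) module_scheme \<Rightarrow> ('a \<Rightarrow> 'a) \<Rightarrow> bool"
  where "is_inner A D \<longleftrightarrow>
    (\<exists>w\<in>carrier A. \<forall>x\<in>carrier A. D x = x \<otimes>\<^bsub>A\<^esub> w \<ominus>\<^bsub>A\<^esub> w \<otimes>\<^bsub>A\<^esub> x)"

text \<open>Needed to pass between cochains, which are extensional, and derivations, which may take
  any value off the carrier.\<close>

lemma is_derivation_cong:
  assumes "ring A" and "\<And>k x. x \<in> carrier A \<Longrightarrow> k \<odot>\<^bsub>A\<^esub> x \<in> carrier A"
    and "\<And>x. x \<in> carrier A \<Longrightarrow> D x = D' x"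
  shows "is_derivation A D \<longleftrightarrow> is_derivation A D'"
proof -
  interpret ring A by fact
  show ?thesis using assms(2,3) unfolding is_derivation_def Pi_iff by simp
qed

lemma is_inner_cong:
  assumes "\<And>x. x \<in> carrier A \<Longrightarrow> D x = D' x"
  shows "is_inner A D \<longleftrightarrow> is_inner A D'"
  using assms unfolding is_inner_def by simp

lemma tuples_0: "tuples A 0 = {[]}"
  by (auto simp: tuples_def)

lemma tuples_1: "tuples A (Suc 0) = (\<lambda>x. [x]) ` carrier A"
  by (auto simp: tuples_def length_Suc_conv)

lemma tuples_2: "tuples A (Suc (Suc 0)) = (\<lambda>(x, y). [x, y]) ` (carrier A \<times> carrier A)"
  by (auto simp: tuples_def length_Suc_conv image_iff)

lemma cochains_0: "hochschild_cochains K A 0 = tuples A 0 \<rightarrow>\<^sub>E carrier A"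
  by (auto simp: hochschild_cochains_def)

lemma cochains_1:
  "f \<in> hochschild_cochains K A 1 \<longleftrightarrow> f \<in> tuples A 1 \<rightarrow>\<^sub>E carrier A \<and>
    (\<forall>x\<in>carrier A. \<forall>y\<in>carrier A. \<forall>k\<in>carrier K.
      f [x \<oplus>\<^bsub>A\<^esub> y] = f [x] \<oplus>\<^bsub>A\<^esub> f [y] \<and> f [k \<odot>\<^bsub>A\<^esub> x] = k \<odot>\<^bsub>A\<^esub> f [x])"
proof -
  have "length xs + 1 + length ys = 1 \<longleftrightarrow> xs = [] \<and> ys = []" for xs ys :: "'b list" by auto
  then show ?thesis unfolding hochschild_cochains_def by auto
qed

lemma (in abelian_group) minus_eq_zero_iff:
  assumes "x \<in> carrier G" "y \<in> carrier G"
  shows "x \<ominus> y = \<zero> \<longleftrightarrow> x = y"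
  using assms by (metis a_inv_closed local.minus_minus minus_eq minus_equality r_neg)

context k_algebra
begin

lemma cocycle_iff:
  "f \<in> hochschild_cocycles (class_ring :: 'k ring) A 1 \<longleftrightarrow>
    f \<in> extensional (tuples A 1) \<and> is_derivation A (\<lambda>x. f [x])"
proof -
  let ?K = "class_ring :: 'k ring"
  have coch: "f \<in> hochschild_cochains ?K A 1 \<longleftrightarrow> f \<in> extensional (tuples A 1) \<and>
      (\<forall>x\<in>carrier A. f [x] \<in> carrier A) \<and>
      (\<forall>x\<in>carrier A. \<forall>y\<in>carrier A. f [x \<oplus> y] = f [x] \<oplus> f [y]) \<and>
      (\<forall>k. \<forall>x\<in>carrier A. f [k \<odot> x] = k \<odot> f [x])"
    unfolding cochains_1 by (auto simp: PiE_def Pi_iff tuples_1)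
  have "hochschild_diff A 1 f = \<zero>\<^bsub>hochschild_module ?K A (Suc 1)\<^esub> \<longleftrightarrow>
      (\<forall>x\<in>carrier A. \<forall>y\<in>carrier A. f [x \<otimes> y] = x \<otimes> f [y] \<oplus> f [x] \<otimes> y)"
    if cl: "\<forall>x\<in>carrier A. f [x] \<in> carrier A"
  proof -
    have "hochschild_diff A 1 f = (\<lambda>xs\<in>tuples A (Suc 1). \<zero>) \<longleftrightarrow>
        (\<forall>xs\<in>tuples A (Suc 1). hochschild_diff A 1 f xs = \<zero>)"
      by (auto simp: fun_eq_iff hochschild_diff_def)
    then have "hochschild_diff A 1 f = \<zero>\<^bsub>hochschild_module ?K A (Suc 1)\<^esub> \<longleftrightarrow>
        (\<forall>x\<in>carrier A. \<forall>y\<in>carrier A. hochschild_diff A 1 f [x, y] = \<zero>)"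
      by (auto simp: hochschild_module_def tuples_2)
    also have "\<dots> \<longleftrightarrow> (\<forall>x\<in>carrier A. \<forall>y\<in>carrier A. f [x \<otimes> y] = x \<otimes> f [y] \<oplus> f [x] \<otimes> y)"
    proof (intro ball_cong refl)
      fix x y assume xy: "x \<in> carrier A" "y \<in> carrier A"
      \<comment> \<open>Reordered, the differential is the right-hand side of the Leibniz rule minus
        the value at the product.\<close>
      have "x \<otimes> f [y] \<ominus> f [x \<otimes> y] \<oplus> f [x] \<otimes> y
          = (x \<otimes> f [y] \<oplus> f [x] \<otimes> y) \<ominus> f [x \<otimes> y]"
        using xy cl by (simp add: minus_eq a_ac)
      then show "hochschild_diff A 1 f [x, y] = \<zero> \<longleftrightarrow> f [x \<otimes> y] = x \<otimes> f [y] \<oplus> f [x] \<otimes> y"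
        using xy cl hochschild_diff_1[OF ring_axioms xy, of f] minus_eq_zero_iff by fastforce
    qed
    finally show ?thesis .
  qed
  then show ?thesis
    unfolding hochschild_cocycles_def is_derivation_def Pi_iff using coch by blast
qed

lemma coboundary_iff:
  "f \<in> hochschild_coboundaries (class_ring :: 'k ring) A 1 \<longleftrightarrow>
    f \<in> extensional (tuples A 1) \<and> is_inner A (\<lambda>x. f [x])"
proof
  assume "f \<in> hochschild_coboundaries class_ring A 1"
  then obtain g where g: "g \<in> tuples A 0 \<rightarrow>\<^sub>E carrier A" "f = hochschild_diff A 0 g"
    by (auto simp: cochains_0)
  then have "g [] \<in> carrier A" by (auto simp: tuples_0)
  moreover have "f \<in> extensional (tuples A 1)" using g by (simp add: hochschild_diff_def)
  ultimately show "f \<in> extensional (tuples A 1) \<and> is_inner A (\<lambda>x. f [x])"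
    unfolding is_inner_def g(2) using hochschild_diff_0[OF ring_axioms, of _ g] by blast
next
  assume f: "f \<in> extensional (tuples A 1) \<and> is_inner A (\<lambda>x. f [x])"
  then obtain w where w: "w \<in> carrier A" "\<And>x. x \<in> carrier A \<Longrightarrow> f [x] = x \<otimes> w \<ominus> w \<otimes> x"
    unfolding is_inner_def by blast
  \<comment> \<open>A cochain of degree zero amounts to its value at the empty list, hence to an
    element of the algebra.\<close>
  let ?g = "\<lambda>xs\<in>tuples A 0. w"
  have "f = hochschild_diff A 0 ?g"
  proof (rule extensionalityI)
    show "f \<in> extensional (tuples A 1)" "hochschild_diff A 0 ?g \<in> extensional (tuples A 1)"
      using f by (simp_all add: hochschild_diff_def)
    show "f xs = hochschild_diff A 0 ?g xs" if "xs \<in> tuples A 1" for xs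
      using that w hochschild_diff_0[OF ring_axioms, of _ ?g] by (auto simp: tuples_0 tuples_1)
  qed
  moreover have "?g \<in> hochschild_cochains class_ring A 0" using w by (auto simp: cochains_0)
  ultimately show "f \<in> hochschild_coboundaries class_ring A 1" by simp
qed

section \<open>Linear structure on derivations and cocycles, and a criterion for dimension
  one\<close>

lemma inner_is_derivation:
  assumes "is_inner A D" shows "is_derivation A D"
proof -
  obtain w where w: "w \<in> carrier A" "\<And>x. x \<in> carrier A \<Longrightarrow> D x = x \<otimes> w \<ominus> w \<otimes> x"
    using assms unfolding is_inner_def by blast
  have neg: "k \<odot> (\<ominus> x) = \<ominus> (k \<odot> x)" if "x \<in> carrier A" for k x
    using that smult_r_minus[of k x] by simp
  have leib: "x \<otimes> y \<otimes> w \<ominus> w \<otimes> (x \<otimes> y) = x \<otimes> (y \<otimes> w \<ominus> w \<otimes> y) \<oplus> (x \<otimes> w \<ominus> w \<otimes> x) \<otimes> y"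
    if xy: "x \<in> carrier A" "y \<in> carrier A" for x y
  proof -
    \<comment> \<open>The two terms x w y of opposite sign are made adjacent so that they
      cancel.\<close>
    have "x \<otimes> (y \<otimes> w \<ominus> w \<otimes> y) \<oplus> (x \<otimes> w \<ominus> w \<otimes> x) \<otimes> y
      = x \<otimes> y \<otimes> w \<oplus> (\<ominus> (x \<otimes> w \<otimes> y) \<oplus> (x \<otimes> w \<otimes> y)) \<oplus> \<ominus> (w \<otimes> (x \<otimes> y))"
      using xy w(1) by (simp add: minus_eq l_distr r_distr l_minus r_minus m_assoc a_assoc)
    then show ?thesis using xy w(1) by (simp add: l_neg minus_eq)
  qed
  show ?thesis unfolding is_derivation_def
  proof (intro conjI ballI allI funcsetI)
    fix x y assume xy: "x \<in> carrier A" "y \<in> carrier A"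
    show "D (x \<otimes> y) = x \<otimes> D y \<oplus> D x \<otimes> y"
      using xy leib[OF xy] by (simp only: w(2) m_closed)
    show "D (x \<oplus> y) = D x \<oplus> D y"
      using xy w(1) by (simp add: w(2) minus_eq l_distr r_distr minus_add a_ac)
  qed (use w(1) in \<open>auto simp: w(2) minus_eq smult_mult mult_smult smult_r_distr neg\<close>)
qed

lemma derivation_add:
  assumes "is_derivation A D" "is_derivation A D'"
  shows "is_derivation A (\<lambda>x. D x \<oplus> D' x)"
  using assms unfolding is_derivation_def
  by (auto simp: Pi_iff l_distr r_distr smult_r_distr a_ac)

lemma derivation_smult:
  assumes "is_derivation A D"
  shows "is_derivation A (\<lambda>x. k \<odot> D x)"
  using assms unfolding is_derivation_def
  by (auto simp: Pi_iff smult_r_distr smult_mult mult_smult smult_assoc1[symmetric] mult.commute)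

lemma inner_add:
  assumes "is_inner A D" "is_inner A D'"
  shows "is_inner A (\<lambda>x. D x \<oplus> D' x)"
proof -
  obtain w w' where w: "w \<in> carrier A" "\<And>x. x \<in> carrier A \<Longrightarrow> D x = x \<otimes> w \<ominus> w \<otimes> x"
    "w' \<in> carrier A" "\<And>x. x \<in> carrier A \<Longrightarrow> D' x = x \<otimes> w' \<ominus> w' \<otimes> x"
    using assms unfolding is_inner_def by blast
  then have "D x \<oplus> D' x = x \<otimes> (w \<oplus> w') \<ominus> (w \<oplus> w') \<otimes> x" if "x \<in> carrier A" for x
    using that by (simp add: minus_eq l_distr r_distr minus_add a_ac)
  then show ?thesis using w unfolding is_inner_def by blast
qed

text \<open>Cocycles are extensional on one-element lists, so \<open>eqI\<close> reduces every axiom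
  to an identity between values in \<open>A\<close>, where the operations are pointwise.\<close>

lemma module_cocycles:
  "Module.module (class_ring :: 'k ring)
    ((hochschild_module class_ring A 1)\<lparr>carrier := hochschild_cocycles class_ring A 1\<rparr>)"
    (is "Module.module ?K ?M")
proof -
  have carr: "f \<in> carrier ?M \<longleftrightarrow> f \<in> extensional (tuples A 1) \<and> is_derivation A (\<lambda>x. f [x])" for f
    using cocycle_iff by simp
  have val: "f [x] \<in> carrier A" if "f \<in> carrier ?M" "x \<in> carrier A" for f x
    using that unfolding carr is_derivation_def by blast
  have eqI: "f = g" if "f \<in> extensional (tuples A 1)" "g \<in> extensional (tuples A 1)"
    "\<And>x. x \<in> carrier A \<Longrightarrow> f [x] = g [x]" for f g :: "'a list \<Rightarrow> 'a"
    using that by (intro extensionalityI[of f "tuples A 1" g]) (auto simp: tuples_1)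
  have add: "(f \<oplus>\<^bsub>?M\<^esub> g) [x] = f [x] \<oplus> g [x]" if "x \<in> carrier A" for f g x
    using that by (simp add: hochschild_module_def tuples_1)
  have smult: "(k \<odot>\<^bsub>?M\<^esub> f) [x] = k \<odot> f [x]" if "x \<in> carrier A" for k f x
    using that by (simp add: hochschild_module_def tuples_1)
  have zero: "\<zero>\<^bsub>?M\<^esub> [x] = \<zero>" if "x \<in> carrier A" for x
    using that by (simp add: hochschild_module_def tuples_1)
  have ext: "f \<oplus>\<^bsub>?M\<^esub> g \<in> extensional (tuples A 1)" "k \<odot>\<^bsub>?M\<^esub> f \<in> extensional (tuples A 1)"
    "\<zero>\<^bsub>?M\<^esub> \<in> extensional (tuples A 1)" for f g k
    by (simp_all add: hochschild_module_def)
  have cong: "is_derivation A (\<lambda>x. F [x])"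
    if "is_derivation A D" "\<And>x. x \<in> carrier A \<Longrightarrow> F [x] = D x" for F D
    using that is_derivation_cong[OF ring_axioms smult_closed, of "\<lambda>x. F [x]" D] by simp
  have add_cl: "f \<oplus>\<^bsub>?M\<^esub> g \<in> carrier ?M" if fg: "f \<in> carrier ?M" "g \<in> carrier ?M" for f g
  proof -
    have "is_derivation A (\<lambda>x. f [x] \<oplus> g [x])"
      using fg derivation_add unfolding carr by blast
    then have "is_derivation A (\<lambda>x. (f \<oplus>\<^bsub>?M\<^esub> g) [x])"
      by (rule cong[of _ "f \<oplus>\<^bsub>?M\<^esub> g"]) (rule add)
    then show ?thesis unfolding carr using ext by blast
  qed
  have smult_cl: "k \<odot>\<^bsub>?M\<^esub> f \<in> carrier ?M" if f: "f \<in> carrier ?M" for k f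
  proof -
    have "is_derivation A (\<lambda>x. k \<odot> f [x])"
      using f derivation_smult unfolding carr by blast
    then have "is_derivation A (\<lambda>x. (k \<odot>\<^bsub>?M\<^esub> f) [x])"
      by (rule cong[of _ "k \<odot>\<^bsub>?M\<^esub> f"]) (rule smult)
    then show ?thesis unfolding carr using ext by blast
  qed
  have zero_cl: "\<zero>\<^bsub>?M\<^esub> \<in> carrier ?M"
  proof -
    have "is_derivation A (\<lambda>x. \<zero>)" unfolding is_derivation_def by auto
    then have "is_derivation A (\<lambda>x. (\<zero>\<^bsub>?M\<^esub>) [x])"
      by (rule cong[of _ "\<zero>\<^bsub>?M\<^esub>"]) (rule zero)
    then show ?thesis unfolding carr using ext by blast
  qed
  have carr_ext: "f \<in> extensional (tuples A 1)" if "f \<in> carrier ?M" for f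
    using that unfolding carr by blast
  show ?thesis
  proof (rule moduleI)
    show "cring ?K" by (rule class_cring.cring_axioms)
    show "abelian_group ?M"
    proof (rule abelian_groupI)
      fix f assume f: "f \<in> carrier ?M"
      show "\<exists>g\<in>carrier ?M. g \<oplus>\<^bsub>?M\<^esub> f = \<zero>\<^bsub>?M\<^esub>"
      proof (rule bexI)
        \<comment> \<open>The additive inverse is taken as a scalar multiple, whose closure is
          already known.\<close>
        show "(-1) \<odot>\<^bsub>?M\<^esub> f \<oplus>\<^bsub>?M\<^esub> f = \<zero>\<^bsub>?M\<^esub>"
        proof (intro eqI ext)
          fix x assume x: "x \<in> carrier A"
          have "(-1) \<odot> f [x] \<oplus> f [x] = \<zero>"
            using smult_l_distr[of "-1" 1 "f [x]"] smult_one smult_l_null val[OF f x] by simp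
          then show "((-1) \<odot>\<^bsub>?M\<^esub> f \<oplus>\<^bsub>?M\<^esub> f) [x] = \<zero>\<^bsub>?M\<^esub> [x]"
            using x by (simp only: add smult zero)
        qed
      qed (rule smult_cl[OF f])
    next
      fix f g h assume "f \<in> carrier ?M" "g \<in> carrier ?M" "h \<in> carrier ?M"
      then show "f \<oplus>\<^bsub>?M\<^esub> g \<oplus>\<^bsub>?M\<^esub> h = f \<oplus>\<^bsub>?M\<^esub> (g \<oplus>\<^bsub>?M\<^esub> h)"
        by (intro eqI ext) (simp only: add a_assoc val)
    next
      fix f g assume "f \<in> carrier ?M" "g \<in> carrier ?M"
      then show "f \<oplus>\<^bsub>?M\<^esub> g = g \<oplus>\<^bsub>?M\<^esub> f"
        by (intro eqI ext) (simp only: add a_comm val)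
    next
      fix f assume f: "f \<in> carrier ?M"
      show "\<zero>\<^bsub>?M\<^esub> \<oplus>\<^bsub>?M\<^esub> f = f"
      proof (intro eqI ext carr_ext f)
        fix x assume x: "x \<in> carrier A"
        show "(\<zero>\<^bsub>?M\<^esub> \<oplus>\<^bsub>?M\<^esub> f) [x] = f [x]"
          unfolding add[OF x] zero[OF x] using val[OF f x] by simp
      qed
    qed (rule zero_cl | (rule add_cl, assumption+))+
  next
    fix k f g assume f: "f \<in> carrier ?M" and g: "g \<in> carrier ?M"
    show "k \<odot>\<^bsub>?M\<^esub> (f \<oplus>\<^bsub>?M\<^esub> g) = k \<odot>\<^bsub>?M\<^esub> f \<oplus>\<^bsub>?M\<^esub> k \<odot>\<^bsub>?M\<^esub> g"
    proof (intro eqI ext)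
      fix x assume x: "x \<in> carrier A"
      show "(k \<odot>\<^bsub>?M\<^esub> (f \<oplus>\<^bsub>?M\<^esub> g)) [x] = (k \<odot>\<^bsub>?M\<^esub> f \<oplus>\<^bsub>?M\<^esub> k \<odot>\<^bsub>?M\<^esub> g) [x]"
        unfolding add[OF x] smult[OF x] using val[OF f x] val[OF g x] by (simp add: smult_r_distr)
    qed
  next
    fix k l f assume f: "f \<in> carrier ?M"
    show "(k \<oplus>\<^bsub>?K\<^esub> l) \<odot>\<^bsub>?M\<^esub> f = k \<odot>\<^bsub>?M\<^esub> f \<oplus>\<^bsub>?M\<^esub> l \<odot>\<^bsub>?M\<^esub> f"
    proof (intro eqI ext)
      fix x assume x: "x \<in> carrier A"
      show "((k \<oplus>\<^bsub>?K\<^esub> l) \<odot>\<^bsub>?M\<^esub> f) [x] = (k \<odot>\<^bsub>?M\<^esub> f \<oplus>\<^bsub>?M\<^esub> l \<odot>\<^bsub>?M\<^esub> f) [x]"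
        unfolding add[OF x] smult[OF x] using smult_l_distr[OF _ _ val[OF f x]] by simp
    qed
    show "(k \<otimes>\<^bsub>?K\<^esub> l) \<odot>\<^bsub>?M\<^esub> f = k \<odot>\<^bsub>?M\<^esub> (l \<odot>\<^bsub>?M\<^esub> f)"
    proof (intro eqI ext)
      fix x assume x: "x \<in> carrier A"
      show "((k \<otimes>\<^bsub>?K\<^esub> l) \<odot>\<^bsub>?M\<^esub> f) [x] = (k \<odot>\<^bsub>?M\<^esub> (l \<odot>\<^bsub>?M\<^esub> f)) [x]"
        unfolding smult[OF x] using smult_assoc1[OF _ _ val[OF f x]] by simp
    qed
    show "\<one>\<^bsub>?K\<^esub> \<odot>\<^bsub>?M\<^esub> f = f"
    proof (intro eqI ext carr_ext f)
      fix x assume x: "x \<in> carrier A"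
      show "(\<one>\<^bsub>?K\<^esub> \<odot>\<^bsub>?M\<^esub> f) [x] = f [x]"
        unfolding smult[OF x] using smult_one[OF val[OF f x]] .
    qed
  qed (rule smult_cl)
qed

text \<open>The functional sending \<open>D\<close> to \<open>coeff (D a)\<close> has exactly the
  inner derivations as its kernel and attains the value one. Applied to cocycles, the criterion for
  quotients by a functional gives the dimension.\<close>

theorem first_cohomology_dim_one:
  fixes coeff :: "'a \<Rightarrow> 'k"
  assumes a: "a \<in> carrier A"
    and add: "\<And>x y. x \<in> carrier A \<Longrightarrow> y \<in> carrier A \<Longrightarrow> coeff (x \<oplus> y) = coeff x + coeff y"
    and smult: "\<And>k x. x \<in> carrier A \<Longrightarrow> coeff (k \<odot> x) = k * coeff x"
    and inner: "\<And>D. is_derivation A D \<Longrightarrow> is_inner A D \<longleftrightarrow> coeff (D a) = 0"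
    and D: "is_derivation A D" "coeff (D a) = 1"
  defines "H \<equiv> hochschild_cohomology (class_ring :: 'k ring) A 1"
  shows "vectorspace class_ring H \<and> vectorspace.fin_dim class_ring H
    \<and> vectorspace.dim class_ring H = 1"
  unfolding H_def hochschild_cohomology_def
proof (rule quotient_by_functional_dim_one[OF module_cocycles])
  let ?M = "(hochschild_module class_ring A 1)\<lparr>carrier := hochschild_cocycles (class_ring :: 'k ring) A 1\<rparr>"
  have val: "f [a] \<in> carrier A" if "f \<in> carrier ?M" for f
    using that a cocycle_iff[of f] unfolding is_derivation_def by auto
  show "coeff ((f \<oplus>\<^bsub>?M\<^esub> g) [a]) = coeff (f [a]) + coeff (g [a])"
    if "f \<in> carrier ?M" "g \<in> carrier ?M" for f g
    using a val[OF that(1)] val[OF that(2)] by (simp add: hochschild_module_def tuples_1 add)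
  show "coeff ((k \<odot>\<^bsub>?M\<^esub> f) [a]) = k * coeff (f [a])" if "f \<in> carrier ?M" for k f
    using a val[OF that] by (simp add: hochschild_module_def tuples_1 smult)
  \<comment> \<open>\<open>hd\<close> turns a map on the algebra into a cochain on one-element
    lists.\<close>
  let ?f = "\<lambda>xs\<in>tuples A 1. D (hd xs)"
  have "is_derivation A (\<lambda>x. ?f [x])"
    using D(1) by (subst is_derivation_cong[OF ring_axioms, of _ D]) (auto simp: tuples_1)
  then show "?f \<in> carrier ?M" using cocycle_iff[of ?f] by simp
  show "coeff (?f [a]) = 1" using a D(2) by (simp add: tuples_1)
  show "hochschild_coboundaries class_ring A 1 = {f \<in> carrier ?M. coeff (f [a]) = 0}"
    using cocycle_iff coboundary_iff inner inner_is_derivation by auto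
qed

end

section \<open>Transport along an isomorphism of algebras\<close>

locale k_algebra_iso = S: k_algebra S for S :: "('k::field, 'a, 'm) module_scheme" +
  fixes Q :: "('k, 'b, 'n) module_scheme" and F :: "'a \<Rightarrow> 'b"
  assumes bij: "bij_betw F (carrier S) (carrier Q)"
    and hom_zero: "F \<zero>\<^bsub>S\<^esub> = \<zero>\<^bsub>Q\<^esub>"
    and hom_one: "F \<one>\<^bsub>S\<^esub> = \<one>\<^bsub>Q\<^esub>"
    and hom_add: "\<And>x y. x \<in> carrier S \<Longrightarrow> y \<in> carrier S \<Longrightarrow> F (x \<oplus>\<^bsub>S\<^esub> y) = F x \<oplus>\<^bsub>Q\<^esub> F y"
    and hom_mult: "\<And>x y. x \<in> carrier S \<Longrightarrow> y \<in> carrier S \<Longrightarrow> F (x \<otimes>\<^bsub>S\<^esub> y) = F x \<otimes>\<^bsub>Q\<^esub> F y"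
    and hom_smult: "\<And>k x. x \<in> carrier S \<Longrightarrow> F (k \<odot>\<^bsub>S\<^esub> x) = k \<odot>\<^bsub>Q\<^esub> F x"
begin

lemma image: "carrier Q = F ` carrier S"
  using bij by (simp add: bij_betw_def)

text \<open>The target is only a record with matching operations, so its algebra axioms are derived
  here. In the application it is the zigzag algebra with its coset operations.\<close>

lemma k_algebra_Q: "k_algebra Q"
proof -
  have "Module.module class_ring Q"
    using hom_smult by (intro module_transport[OF S.module_axioms bij hom_zero hom_add]) auto
  moreover have "F \<in> ring_iso S Q"
    unfolding ring_iso_def using bij hom_one hom_add hom_mult
    by (auto simp: image intro: ring_hom_memI)
  \<comment> \<open>The transported ring has zero \<open>F \<zero>\<close>, which
    \<open>hom_zero\<close> identifies with the zero of \<open>Q\<close>.\<close>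
  then have "ring (Q\<lparr>zero := F \<zero>\<^bsub>S\<^esub>\<rparr>)" by (rule S.A.ring_iso_imp_img_ring)
  then have "ring Q" by (simp add: hom_zero)
  ultimately show ?thesis
    by (intro k_algebra.intro k_algebra_axioms.intro)
      (auto simp: image S.smult_mult S.mult_smult simp flip: hom_smult hom_mult)
qed

definition G :: "'b \<Rightarrow> 'a"
  where "G = inv_into (carrier S) F"

lemma G_F [simp]: "x \<in> carrier S \<Longrightarrow> G (F x) = x"
  unfolding G_def using bij by (simp add: bij_betw_inv_into_left)

lemma F_G [simp]: "y \<in> carrier Q \<Longrightarrow> F (G y) = y"
  unfolding G_def using bij by (simp add: bij_betw_inv_into_right)

lemma F_closed [simp]: "x \<in> carrier S \<Longrightarrow> F x \<in> carrier Q"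
  by (simp add: image)

lemma G_closed [simp]: "y \<in> carrier Q \<Longrightarrow> G y \<in> carrier S"
  unfolding G_def using bij by (simp add: bij_betw_def inv_into_into)

lemma inverse_iso: "k_algebra_iso Q S G"
proof -
  interpret Q: k_algebra Q by (rule k_algebra_Q)
  show ?thesis
    by (intro k_algebra_iso.intro k_algebra_iso_axioms.intro k_algebra_Q)
      (auto simp: image bij_betw_inv_into[OF bij, folded G_def, unfolded image]
        simp flip: hom_zero hom_one hom_add hom_mult hom_smult)
qed

lemma derivation_transport:
  assumes "is_derivation S D"
  shows "is_derivation Q (\<lambda>y. F (D (G y)))"
proof -
  have D: "D x \<in> carrier S" if "x \<in> carrier S" for x
    using assms that unfolding is_derivation_def by blast
  show ?thesis
    using assms unfolding is_derivation_def
    by (auto simp: image D S.A.m_closed simp flip: hom_add hom_mult hom_smult)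
qed

lemma inner_transport:
  assumes "is_inner S D"
  shows "is_inner Q (\<lambda>y. F (D (G y)))"
proof -
  interpret Q: k_algebra Q by (rule k_algebra_Q)
  obtain w where w: "w \<in> carrier S" "\<And>x. x \<in> carrier S \<Longrightarrow> D x = x \<otimes>\<^bsub>S\<^esub> w \<ominus>\<^bsub>S\<^esub> w \<otimes>\<^bsub>S\<^esub> x"
    using assms unfolding is_inner_def by blast
  have neg: "F (\<ominus>\<^bsub>S\<^esub> x) = \<ominus>\<^bsub>Q\<^esub> F x" if "x \<in> carrier S" for x
    using that Q.minus_equality[of "F (\<ominus>\<^bsub>S\<^esub> x)" "F x"] hom_add[of "\<ominus>\<^bsub>S\<^esub> x" x]
    by (simp add: S.l_neg hom_zero)
  have "F (D (G y)) = y \<otimes>\<^bsub>Q\<^esub> F w \<ominus>\<^bsub>Q\<^esub> F w \<otimes>\<^bsub>Q\<^esub> y" if "y \<in> carrier Q" for y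
    using that w by (simp add: S.minus_eq Q.minus_eq hom_add hom_mult neg)
  then show ?thesis unfolding is_inner_def using w(1) by (intro bexI[of _ "F w"]) auto
qed

lemma first_cohomology_dim_one_transport:
  fixes coeff :: "'a \<Rightarrow> 'k"
  assumes a: "a \<in> carrier S"
    and add: "\<And>x y. x \<in> carrier S \<Longrightarrow> y \<in> carrier S \<Longrightarrow> coeff (x \<oplus>\<^bsub>S\<^esub> y) = coeff x + coeff y"
    and smult: "\<And>k x. x \<in> carrier S \<Longrightarrow> coeff (k \<odot>\<^bsub>S\<^esub> x) = k * coeff x"
    and inner: "\<And>D. is_derivation S D \<Longrightarrow> is_inner S D \<longleftrightarrow> coeff (D a) = 0"
    and D: "is_derivation S D" "coeff (D a) = 1"
  defines "H \<equiv> hochschild_cohomology (class_ring :: 'k ring) Q 1"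
  shows "vectorspace class_ring H \<and> vectorspace.fin_dim class_ring H
    \<and> vectorspace.dim class_ring H = 1"
proof -
  interpret Q: k_algebra Q by (rule k_algebra_Q)
  interpret inv: k_algebra_iso Q S G by (rule inverse_iso)
  \<comment> \<open>The inverse built from \<open>G\<close> is again a choice of preimages and is
    known to agree with \<open>F\<close> on the carrier only.\<close>
  have inv_G: "inv.G x = F x" if "x \<in> carrier S" for x
    using that by (metis G_F F_closed inv.G_F)
  show ?thesis unfolding H_def
  proof (rule Q.first_cohomology_dim_one[of "F a" "\<lambda>y. coeff (G y)" "\<lambda>y. F (D (G y))"])
    show "F a \<in> carrier Q" using a by simp
    show "coeff (G (x \<oplus>\<^bsub>Q\<^esub> y)) = coeff (G x) + coeff (G y)"
      if "x \<in> carrier Q" "y \<in> carrier Q" for x y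
      using that by (simp add: inv.hom_add add)
    show "coeff (G (k \<odot>\<^bsub>Q\<^esub> x)) = k * coeff (G x)" if "x \<in> carrier Q" for k x
      using that by (simp add: inv.hom_smult smult)
    show "is_derivation Q (\<lambda>y. F (D (G y)))" by (rule derivation_transport[OF D(1)])
    have "D a \<in> carrier S" using D(1) a unfolding is_derivation_def by blast
    then show "coeff (G (F (D (G (F a))))) = 1" using a D(2) by simp
    fix D' assume D': "is_derivation Q D'"
    have val: "D' y \<in> carrier Q" if "y \<in> carrier Q" for y
      using D' that unfolding is_derivation_def by blast
    \<comment> \<open>A derivation of \<open>Q\<close> is pulled back to \<open>S\<close>, where the
      criterion \<open>inner\<close> applies.\<close>
    let ?D = "\<lambda>x. G (D' (inv.G x))"
    have "is_inner Q D' \<longleftrightarrow> is_inner S ?D"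
    proof
      show "is_inner S ?D" if "is_inner Q D'" by (rule inv.inner_transport[OF that])
      assume "is_inner S ?D"
      then have "is_inner Q (\<lambda>y. F (?D (G y)))" by (rule inner_transport)
      then show "is_inner Q D'"
        by (subst is_inner_cong[of Q _ "\<lambda>y. F (?D (G y))"]) (simp_all add: inv_G val)
    qed
    also have "\<dots> \<longleftrightarrow> coeff (G (D' (F a))) = 0"
      using inner[OF inv.derivation_transport[OF D']] a by (simp add: inv_G)
    finally show "is_inner Q D' \<longleftrightarrow> coeff (G (D' (F a))) = 0" .
  qed
qed

end

section \<open>Arc functions on trees\<close>

context graph
begin

text \<open>For an arc, symmetry of the graph provides the opposite arc and the absence of multiple
  arcs makes it unique.\<close>

definition opposite :: "'b \<Rightarrow> 'b"
  where "opposite a = (THE b. b \<in> arcs G \<and> tail G b = head G a \<and> head G b = tail G a)"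

lemma arc_eqI:
  "a \<in> arcs G \<Longrightarrow> b \<in> arcs G \<Longrightarrow> tail G a = tail G b \<Longrightarrow> head G a = head G b \<Longrightarrow> a = b"
  using no_multi_arcs by (auto simp: arc_to_ends_def)

lemma opposite_eqI:
  assumes "a \<in> arcs G" "b \<in> arcs G" "tail G b = head G a" "head G b = tail G a"
  shows "opposite a = b"
  unfolding opposite_def using assms arc_eqI by (intro the_equality) auto

lemma
  assumes "a \<in> arcs G"
  shows opposite_in_arcs [simp]: "opposite a \<in> arcs G"
    and tail_opposite [simp]: "tail G (opposite a) = head G a"
    and head_opposite [simp]: "head G (opposite a) = tail G a"
proof -
  obtain b where "b \<in> arcs G" "tail G b = head G a" "head G b = tail G a"
    using assms sym_arcs unfolding symmetric_conv by metis
  with opposite_eqI[OF assms this]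
  show "opposite a \<in> arcs G" "tail G (opposite a) = head G a" "head G (opposite a) = tail G a"
    by simp_all
qed

lemma opposite_opposite [simp]: "a \<in> arcs G \<Longrightarrow> opposite (opposite a) = a"
  by (rule opposite_eqI) simp_all

lemma awalk_two_iff:
  "awalk u [a, b] u \<longleftrightarrow> a \<in> arcs G \<and> tail G a = u \<and> b = opposite a"
  using opposite_eqI[of a b] by (auto simp: awalk_Cons_iff awalk_Nil_iff)

text \<open>Induction on the length: a nonempty closed walk that is not a cycle contains a shorter
  closed walk, and cutting it out leaves another one. Cycles have length at most two by acyclicity;
  loops are excluded, and a step out and back cancels by antisymmetry.\<close>

lemma closed_walk_sum_zero:
  fixes c :: "'b \<Rightarrow> 'c :: ab_group_add"
  assumes "acyclic_graph G"
    and anti: "\<And>a. a \<in> arcs G \<Longrightarrow> c a + c (opposite a) = 0"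
    and "awalk u p u"
  shows "sum_list (map c p) = 0"
  using assms(3)
proof (induction "length p" arbitrary: p u rule: less_induct)
  case less
  show ?case
  proof (cases "p = [] \<or> cycle p")
    case True
    then consider "p = []" | a where "p = [a]" | a b where "p = [a, b]"
      using assms(1) unfolding acyclic_graph_def
      by (cases p rule: remdups_adj.cases) (force simp: Suc_le_eq numeral_3_eq_3)+
    then show ?thesis
    proof cases
      case 2
      then show ?thesis using less.prems no_loops[of a] by (auto simp: awalk_Cons_iff awalk_Nil_iff)
    next
      case 3
      then show ?thesis using less.prems anti by (auto simp: awalk_two_iff)
    qed simp
  next
    case False
    then obtain a q where p: "p = a # q" by (cases p) auto
    have q: "awalk (head G a) q u" "tail G a = u" "a \<in> arcs G"
      using less.prems p by (auto simp: awalk_Cons_iff)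
    \<comment> \<open>Since \<open>p\<close> is not a cycle, a vertex repeats after the first arc.
      The piece \<open>r\<close> cut out there is nonempty and avoids that arc, so both
      \<open>r\<close> and the rest are shorter than \<open>p\<close>.\<close>
    moreover have "\<not> distinct (awalk_verts (head G a) q)"
      using False less.prems p by (auto simp: cycle_def)
    ultimately obtain q1 r q2 w where r: "q = q1 @ r @ q2" "awalk (head G a) q1 w" "awalk w r w"
      "awalk w q2 u" "closed_w r"
      by (metis awalk_cyc_decompE')
    have "r \<noteq> []" using r(5) by (auto simp: closed_w_def)
    have "awalk u (a # q1 @ q2) u"
      using q r by (auto simp: awalk_Cons_iff)
    then have "sum_list (map c (a # q1 @ q2)) = 0"
      by (rule less.hyps[rotated]) (use p r \<open>r \<noteq> []\<close> in auto)
    moreover have "sum_list (map c r) = 0"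
      by (rule less.hyps[rotated, OF r(3)]) (use p r in auto)
    ultimately show ?thesis using p r by simp
  qed
qed

lemma connected_awalk:
  assumes "connected G" "u \<in> verts G" "v \<in> verts G"
  obtains p where "awalk u p v"
  using symmetric_connected_imp_strongly_connected[OF sym_arcs assms(1)] assms(2,3) that
  unfolding strongly_connected_def reachable_awalk by blast

text \<open>The potential of a vertex is the sum of \<open>c\<close> along a chosen walk from a
  root. As sums along closed walks vanish, the choice does not matter.\<close>

lemma antisymmetric_imp_gradient:
  fixes c :: "'b \<Rightarrow> 'c :: ab_group_add"
  assumes "acyclic_graph G" and "connected G"
    and anti: "\<And>a. a \<in> arcs G \<Longrightarrow> c a + c (opposite a) = 0"
  obtains x where "\<And>a. a \<in> arcs G \<Longrightarrow> c a = x (head G a) - x (tail G a)"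
proof (cases "arcs G = {}")
  case True
  then show ?thesis using that by auto
next
  case False
  then obtain r where r: "r \<in> verts G" by (meson ex_in_conv head_in_verts)
  define P where "P v = (SOME p. awalk r p v)" for v
  have P: "awalk r (P v) v" if "v \<in> verts G" for v
    using connected_awalk[OF assms(2) r that] unfolding P_def by (metis someI_ex)
  show ?thesis
  proof (rule that)
    fix a assume a: "a \<in> arcs G"
    \<comment> \<open>One return walk closes both the walk to the head of \<open>a\<close> and the
      walk to its tail followed by \<open>a\<close>. Comparing the two vanishing sums yields
      \<open>c a\<close>.\<close>
    obtain q where q: "awalk (head G a) q r"
      using connected_awalk[OF assms(2) _ r] a by (meson head_in_verts)
    have w: "awalk r (P (head G a) @ q) r" "awalk r (P (tail G a) @ a # q) r"
      using P[of "head G a"] P[of "tail G a"] a q by (auto simp: awalk_Cons_iff)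
    have closed: "sum_list (map c p) = 0" if "awalk u p u" for u p
      using closed_walk_sum_zero[OF assms(1) _ that, of c] anti by blast
    have "sum_list (map c (P (head G a))) + sum_list (map c q) = 0"
      using closed[OF w(1)] by simp
    moreover have "(sum_list (map c (P (tail G a))) + c a) + sum_list (map c q) = 0"
      using closed[OF w(2)] by (simp add: add.assoc)
    ultimately have "sum_list (map c (P (tail G a))) + c a = sum_list (map c (P (head G a)))"
      by (metis add_right_cancel)
    then show "c a = sum_list (map c (P (head G a))) - sum_list (map c (P (tail G a)))"
      by (metis add_diff_cancel_left')
  qed
qed

lemma connected_constant:
  assumes "connected G" and "\<And>a. a \<in> arcs G \<Longrightarrow> s (tail G a) = s (head G a)"
    and "u \<in> verts G" "v \<in> verts G"
  shows "s u = s v"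
proof -
  obtain p where "awalk u p v" using connected_awalk[OF assms(1,3,4)] .
  then show ?thesis
    by (induction p arbitrary: u) (auto simp: awalk_Cons_iff awalk_Nil_iff assms(2))
qed

text \<open>Rules out isolated vertices: they have no 2-cycle, so their basis element
  \<open>Loop\<close> would not come from the path algebra.\<close>

lemma connected_out_arcs:
  assumes "connected G" "card (verts G) > 1" "u \<in> verts G"
  shows "out_arcs G u \<noteq> {}"
proof -
  obtain v where v: "v \<in> verts G" "v \<noteq> u"
    using assms(2) card_mono[of "{u}" "verts G"] by fastforce
  obtain p where "awalk u p v" using connected_awalk[OF assms(1,3) v(1)] .
  then show ?thesis using v by (cases p) (auto simp: awalk_Cons_iff awalk_Nil_iff out_arcs_def)
qed

end

section \<open>Derivations in coordinates\<close>

text \<open>\<open>Loop u\<close> stands for the common class l_u of the 2-cycles at u, not for a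
  loop of the graph.\<close>

datatype ('v, 'e) zigzag_basis = Vtx 'v | Arr 'e | Loop 'v

definition basis_vec :: "'b \<Rightarrow> 'b \<Rightarrow> 'k::field"
  where "basis_vec x = (\<lambda>y. if y = x then 1 else 0)"

lemma basis_vec_apply: "basis_vec x y = (if y = x then 1 else 0)"
  by (simp add: basis_vec_def)

context graph
begin

definition zigzag_basis :: "('a, 'b) zigzag_basis set"
  where "zigzag_basis = Vtx ` verts G \<union> Arr ` arcs G \<union> Loop ` verts G"

text \<open>Each coordinate runs over the factorisations of its basis element. For l_u these are e_u
  l_u, l_u e_u, and a times its opposite for every arrow a leaving u.\<close>

definition zigzag_mult ::
  "(('a, 'b) zigzag_basis \<Rightarrow> 'k::field) \<Rightarrow> (('a, 'b) zigzag_basis \<Rightarrow> 'k) \<Rightarrow> ('a, 'b) zigzag_basis \<Rightarrow> 'k"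
  where "zigzag_mult f g x = (case x of
      Vtx u \<Rightarrow> f (Vtx u) * g (Vtx u)
    | Arr a \<Rightarrow> f (Vtx (tail G a)) * g (Arr a) + f (Arr a) * g (Vtx (head G a))
    | Loop u \<Rightarrow> f (Vtx u) * g (Loop u) + f (Loop u) * g (Vtx u)
        + (\<Sum>a\<in>out_arcs G u. f (Arr a) * g (Arr (opposite a))))"

text \<open>Coordinates vanish off the basis, so equality in the algebra is equality of
  functions.\<close>

definition coord_algebra :: "('k::field, ('a, 'b) zigzag_basis \<Rightarrow> 'k) module"
  where "coord_algebra =
    \<lparr>carrier = {f. \<forall>x. x \<notin> zigzag_basis \<longrightarrow> f x = 0}, mult = zigzag_mult,
     one = (\<lambda>x. case x of Vtx u \<Rightarrow> if u \<in> verts G then 1 else 0 | _ \<Rightarrow> 0),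
     zero = (\<lambda>_. 0), add = (\<lambda>f g x. f x + g x), smult = (\<lambda>k f x. k * f x)\<rparr>"

lemma zigzag_mult_simps [simp]:
  "zigzag_mult f g (Vtx u) = f (Vtx u) * g (Vtx u)"
  "zigzag_mult f g (Arr a) = f (Vtx (tail G a)) * g (Arr a) + f (Arr a) * g (Vtx (head G a))"
  "zigzag_mult f g (Loop u) = f (Vtx u) * g (Loop u) + f (Loop u) * g (Vtx u)
        + (\<Sum>a\<in>out_arcs G u. f (Arr a) * g (Arr (opposite a)))"
  by (simp_all add: zigzag_mult_def)

lemma zigzag_basis_iff [simp]:
  "Vtx u \<in> zigzag_basis \<longleftrightarrow> u \<in> verts G" "Arr a \<in> zigzag_basis \<longleftrightarrow> a \<in> arcs G"
  "Loop u \<in> zigzag_basis \<longleftrightarrow> u \<in> verts G"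
  by (auto simp: zigzag_basis_def)

lemma finite_zigzag_basis: "finite zigzag_basis"
  by (simp add: zigzag_basis_def)

lemma coord_algebra_simps:
  "f \<in> carrier coord_algebra \<longleftrightarrow> (\<forall>x. x \<notin> zigzag_basis \<longrightarrow> f x = 0)"
  "mult coord_algebra = zigzag_mult"
  "zero coord_algebra = (\<lambda>_. 0)"
  "add coord_algebra = (\<lambda>f g x. f x + g x)"
  "smult coord_algebra = (\<lambda>k f x. k * f x)"
  by (simp_all add: coord_algebra_def)

lemma out_arcs_outside: "u \<notin> verts G \<Longrightarrow> out_arcs G u = {}"
  by (auto simp: out_arcs_def)

lemma zigzag_mult_closed:
  assumes "f \<in> carrier coord_algebra" "g \<in> carrier coord_algebra"
  shows "zigzag_mult f g \<in> carrier coord_algebra"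
  unfolding coord_algebra_simps
proof (intro allI impI)
  fix x :: "('a, 'b) zigzag_basis" assume "x \<notin> zigzag_basis"
  then show "zigzag_mult f g x = 0"
    using assms by (cases x) (auto simp: coord_algebra_simps out_arcs_outside)
qed

text \<open>At \<open>Vtx\<close> and \<open>Arr\<close> this is distributivity. At
  \<open>Loop u\<close> the sums match because an arrow leaving u has tail u, its opposite ends at
  u, and both bracketings use the same middle vertex.\<close>

lemma zigzag_mult_assoc: "zigzag_mult (zigzag_mult f g) h = zigzag_mult f (zigzag_mult g h)"
proof
  fix x
  show "zigzag_mult (zigzag_mult f g) h x = zigzag_mult f (zigzag_mult g h) x"
  proof (cases x)
    case (Loop u)
    have "(\<Sum>a\<in>out_arcs G u. (f (Vtx (tail G a)) * g (Arr a) + f (Arr a) * g (Vtx (head G a))) * h (Arr (opposite a)))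
      = (\<Sum>a\<in>out_arcs G u. f (Vtx u) * (g (Arr a) * h (Arr (opposite a)))
          + f (Arr a) * g (Vtx (head G a)) * h (Arr (opposite a)))"
      by (rule sum.cong) (auto simp: algebra_simps)
    moreover have "(\<Sum>a\<in>out_arcs G u. f (Arr a) * (g (Vtx (tail G (opposite a))) * h (Arr (opposite a))
          + g (Arr (opposite a)) * h (Vtx (head G (opposite a)))))
      = (\<Sum>a\<in>out_arcs G u. f (Arr a) * g (Vtx (head G a)) * h (Arr (opposite a))
          + f (Arr a) * g (Arr (opposite a)) * h (Vtx u))"
      by (rule sum.cong) (auto simp: algebra_simps)
    ultimately show ?thesis
      by (simp add: Loop sum.distrib distrib_left distrib_right mult.assoc
          sum_distrib_left sum_distrib_right)
  qed (simp_all add: algebra_simps)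
qed

lemma k_algebra_coord: "k_algebra (coord_algebra :: ('k::field, ('a, 'b) zigzag_basis \<Rightarrow> 'k) module)"
  (is "k_algebra ?B")
proof -
  have one: "zigzag_mult \<one>\<^bsub>?B\<^esub> f = f" "zigzag_mult f \<one>\<^bsub>?B\<^esub> = f" if "f \<in> carrier ?B" for f
  proof -
    have "zigzag_mult \<one>\<^bsub>?B\<^esub> f x = f x \<and> zigzag_mult f \<one>\<^bsub>?B\<^esub> x = f x" for x
      using that by (cases x)
        (auto simp: coord_algebra_def,
          (metis zigzag_basis_iff(2) tail_in_verts head_in_verts)+)
    then show "zigzag_mult \<one>\<^bsub>?B\<^esub> f = f" "zigzag_mult f \<one>\<^bsub>?B\<^esub> = f" by blast+
  qed
  have one_cl: "\<one>\<^bsub>?B\<^esub> \<in> carrier ?B"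
    by (auto simp: coord_algebra_def split: zigzag_basis.split)
  have ab: "abelian_group ?B"
  proof (rule abelian_groupI)
    fix f assume "f \<in> carrier ?B"
    then show "\<exists>g\<in>carrier ?B. g \<oplus>\<^bsub>?B\<^esub> f = \<zero>\<^bsub>?B\<^esub>"
      by (intro bexI[of _ "\<lambda>x. - f x"]) (auto simp: coord_algebra_simps)
  qed (auto simp: coord_algebra_simps algebra_simps)
  have distr: "zigzag_mult (\<lambda>x. f x + g x) h = (\<lambda>x. zigzag_mult f h x + zigzag_mult g h x)"
    "zigzag_mult h (\<lambda>x. f x + g x) = (\<lambda>x. zigzag_mult h f x + zigzag_mult h g x)"
    for f g h :: "('a, 'b) zigzag_basis \<Rightarrow> 'k"
    by (rule ext, case_tac x; simp add: algebra_simps sum.distrib)+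
  have scal: "zigzag_mult (\<lambda>x. k * f x) g = (\<lambda>x. k * zigzag_mult f g x)"
    "zigzag_mult f (\<lambda>x. k * g x) = (\<lambda>x. k * zigzag_mult f g x)"
    for k and f g :: "('a, 'b) zigzag_basis \<Rightarrow> 'k"
    by (rule ext, case_tac x; simp add: algebra_simps sum_distrib_left)+
  have ring: "ring ?B"
    by (intro ringI ab Group.monoidI)
      (use zigzag_mult_closed one one_cl in \<open>auto simp: coord_algebra_simps(2,4) distr zigzag_mult_assoc\<close>)
  have "Module.module (class_ring :: 'k ring) ?B"
    by (intro moduleI ab class_cring.cring_axioms) (auto simp: coord_algebra_simps algebra_simps)
  with ring show ?thesis
    by (intro k_algebra.intro k_algebra_axioms.intro) (auto simp: coord_algebra_simps scal)
qed

lemma basis_vec_closed: "basis_vec x \<in> carrier coord_algebra \<longleftrightarrow> x \<in> zigzag_basis"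
  by (auto simp: coord_algebra_simps basis_vec_def)

text \<open>Subtraction in the record goes through the abstract additive inverse; cancelling
  \<open>g\<close> shows that it is pointwise.\<close>

lemma coord_minus:
  assumes "f \<in> carrier coord_algebra" "g \<in> carrier coord_algebra"
  shows "f \<ominus>\<^bsub>coord_algebra\<^esub> g = (\<lambda>x. f x - g x)"
proof -
  interpret B: k_algebra coord_algebra by (rule k_algebra_coord)
  let ?h = "\<lambda>x. f x - g x"
  have h: "?h \<in> carrier coord_algebra" using assms by (auto simp: coord_algebra_simps)
  have "f = ?h \<oplus>\<^bsub>coord_algebra\<^esub> g" by (simp add: coord_algebra_simps)
  then have "f \<ominus>\<^bsub>coord_algebra\<^esub> g = ?h \<oplus>\<^bsub>coord_algebra\<^esub> g \<ominus>\<^bsub>coord_algebra\<^esub> g" by simp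
  also have "\<dots> = ?h" using h assms(2) by (simp add: B.minus_eq B.a_assoc B.r_neg)
  finally show ?thesis .
qed

lemma coord_derivationD:
  fixes D :: "(('a, 'b) zigzag_basis \<Rightarrow> 'k::field) \<Rightarrow> ('a, 'b) zigzag_basis \<Rightarrow> 'k"
  assumes "is_derivation coord_algebra D"
  shows "f \<in> carrier coord_algebra \<Longrightarrow> x \<notin> zigzag_basis \<Longrightarrow> D f x = 0"
    and "f \<in> carrier coord_algebra \<Longrightarrow> g \<in> carrier coord_algebra \<Longrightarrow> D (\<lambda>x. f x + g x) = (\<lambda>x. D f x + D g x)"
    and "f \<in> carrier coord_algebra \<Longrightarrow> D (\<lambda>x. k * f x) = (\<lambda>x. k * D f x)"
    and "f \<in> carrier coord_algebra \<Longrightarrow> g \<in> carrier coord_algebra \<Longrightarrow>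
      D (zigzag_mult f g) = (\<lambda>x. zigzag_mult f (D g) x + zigzag_mult (D f) g x)"
  using assms unfolding is_derivation_def Pi_iff by (simp_all add: coord_algebra_simps)

lemma coord_is_inner_iff:
  fixes D :: "(('a, 'b) zigzag_basis \<Rightarrow> 'k::field) \<Rightarrow> ('a, 'b) zigzag_basis \<Rightarrow> 'k"
  shows "is_inner coord_algebra D \<longleftrightarrow>
    (\<exists>w\<in>carrier coord_algebra. \<forall>f\<in>carrier coord_algebra.
      D f = (\<lambda>x. zigzag_mult f w x - zigzag_mult w f x))"
  unfolding is_inner_def
  by (auto simp: coord_minus coord_algebra_simps(2) zigzag_mult_closed)

text \<open>A function on the finite basis is a combination of basis vectors. The induction enlarges
  the set \<open>S\<close> to which \<open>f\<close> is restricted, one basis element at a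
  time.\<close>

lemma derivation_zero_on_basis:
  fixes D :: "(('a, 'b) zigzag_basis \<Rightarrow> 'k::field) \<Rightarrow> ('a, 'b) zigzag_basis \<Rightarrow> 'k"
  assumes D: "is_derivation coord_algebra D"
    and zero: "\<And>x. x \<in> zigzag_basis \<Longrightarrow> D (basis_vec x) = (\<lambda>_. 0)"
    and f: "f \<in> carrier coord_algebra"
  shows "D f = (\<lambda>_. 0)"
proof -
  note D = coord_derivationD[OF D]
  have restr: "(\<lambda>x. if x \<in> S then f x else 0) \<in> carrier coord_algebra" for S
    using f by (auto simp: coord_algebra_simps)
  have "D (\<lambda>x. if x \<in> S then f x else 0) = (\<lambda>_. 0)" if "finite S" "S \<subseteq> zigzag_basis" for S
    using that
  proof (induction S)
    case empty
    then show ?case using D(3)[OF f, of 0] by simp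
  next
    case (insert s S)
    have s: "basis_vec s \<in> carrier coord_algebra" using insert.prems by (simp add: basis_vec_closed)
    then have s': "(\<lambda>x. f s * basis_vec s x) \<in> carrier coord_algebra"
      by (auto simp: coord_algebra_simps)
    have "(\<lambda>x. if x \<in> insert s S then f x else 0)
        = (\<lambda>x. f s * basis_vec s x + (if x \<in> S then f x else 0))"
      using insert.hyps by (auto simp: basis_vec_def)
    then show ?case
      using insert D(2)[OF s' restr[of S]] D(3)[OF s, of "f s"] zero by simp
  qed
  from this[OF finite_zigzag_basis] have "D (\<lambda>x. if x \<in> zigzag_basis then f x else 0) = (\<lambda>_. 0)" by simp
  moreover have "(\<lambda>x. if x \<in> zigzag_basis then f x else 0) = f"
    using f by (auto simp: coord_algebra_simps)
  ultimately show ?thesis by simp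
qed

section \<open>Commutators and products with basis elements\<close>

lemma commutator_derivation:
  assumes "w \<in> carrier coord_algebra"
  shows "is_derivation coord_algebra (\<lambda>f x. zigzag_mult f w x - zigzag_mult w f x)"
    and "is_inner coord_algebra (\<lambda>f x. zigzag_mult f w x - zigzag_mult w f x)"
proof -
  interpret B: k_algebra coord_algebra by (rule k_algebra_coord)
  show *: "is_inner coord_algebra (\<lambda>f x. zigzag_mult f w x - zigzag_mult w f x)"
    unfolding coord_is_inner_iff using assms by blast
  show "is_derivation coord_algebra (\<lambda>f x. zigzag_mult f w x - zigzag_mult w f x)"
    by (rule B.inner_is_derivation[OF *])
qed

lemma derivation_diff_commutator:
  assumes "is_derivation coord_algebra D" "w \<in> carrier coord_algebra"
  shows "is_derivation coord_algebra (\<lambda>f x. D f x - (zigzag_mult f w x - zigzag_mult w f x))"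
proof -
  interpret B: k_algebra coord_algebra by (rule k_algebra_coord)
  show ?thesis
    using B.derivation_add[OF assms(1) B.derivation_smult[OF commutator_derivation(1)[OF assms(2)], of "-1"]]
    by (simp add: coord_algebra_simps algebra_simps)
qed

text \<open>These are the Peirce projections: e_u on the left selects the basis elements starting at
  u, on the right those ending at u.\<close>

lemma mult_Vtx_apply:
  "zigzag_mult (basis_vec (Vtx u)) g x =
    (case x of Vtx v \<Rightarrow> if v = u then g x else 0 | Arr a \<Rightarrow> if tail G a = u then g x else 0
      | Loop v \<Rightarrow> if v = u then g x else 0)"
  "zigzag_mult g (basis_vec (Vtx u)) x =
    (case x of Vtx v \<Rightarrow> if v = u then g x else 0 | Arr a \<Rightarrow> if head G a = u then g x else 0
      | Loop v \<Rightarrow> if v = u then g x else 0)"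
  by (cases x; simp add: basis_vec_apply)+

lemma mult_Vtx_Vtx:
  "zigzag_mult (basis_vec (Vtx u)) (basis_vec (Vtx v)) = (if u = v then basis_vec (Vtx u) else (\<lambda>_. 0))"
  by (rule ext) (auto simp: mult_Vtx_apply basis_vec_apply split: zigzag_basis.split)

lemma mult_Vtx_Arr:
  "zigzag_mult (basis_vec (Vtx (tail G a))) (basis_vec (Arr a)) = basis_vec (Arr a)"
  "zigzag_mult (basis_vec (Arr a)) (basis_vec (Vtx (head G a))) = basis_vec (Arr a)"
  by (rule ext; auto simp: mult_Vtx_apply basis_vec_apply split: zigzag_basis.split)+

lemma sum_out_arcs_delta:
  "a \<in> arcs G \<Longrightarrow> (\<Sum>b\<in>out_arcs G u. if b = a then h b else 0) = (if u = tail G a then h a else 0)"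
  by (subst sum.delta) auto

lemma mult_Arr_apply_Loop:
  assumes "a \<in> arcs G"
  shows "zigzag_mult (basis_vec (Arr a)) g (Loop u) = (if u = tail G a then g (Arr (opposite a)) else 0)"
    and "zigzag_mult g (basis_vec (Arr (opposite a))) (Loop u) = (if u = tail G a then g (Arr a) else 0)"
proof -
  have "(\<Sum>b\<in>out_arcs G u. basis_vec (Arr a) (Arr b) * g (Arr (opposite b)))
      = (\<Sum>b\<in>out_arcs G u. if b = a then g (Arr (opposite b)) else 0)"
    by (rule sum.cong) (auto simp: basis_vec_apply)
  then show "zigzag_mult (basis_vec (Arr a)) g (Loop u) = (if u = tail G a then g (Arr (opposite a)) else 0)"
    using assms by (simp add: basis_vec_apply sum_out_arcs_delta)
  \<comment> \<open>\<open>opposite\<close> is injective on arcs, so the sum has at most one nonzero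
    term.\<close>
  have "opposite b = opposite a \<longleftrightarrow> b = a" if "b \<in> arcs G" for b
    using opposite_opposite[OF that] opposite_opposite[OF assms] by metis
  then have "(\<Sum>b\<in>out_arcs G u. g (Arr b) * basis_vec (Arr (opposite a)) (Arr (opposite b)))
      = (\<Sum>b\<in>out_arcs G u. if b = a then g (Arr b) else 0)"
    by (intro sum.cong) (auto simp: basis_vec_apply)
  then show "zigzag_mult g (basis_vec (Arr (opposite a))) (Loop u) = (if u = tail G a then g (Arr a) else 0)"
    using assms by (simp add: basis_vec_apply sum_out_arcs_delta)
qed

lemma mult_Arr_Arr:
  assumes "a \<in> arcs G"
  shows "zigzag_mult (basis_vec (Arr a)) (basis_vec (Arr (opposite a))) = basis_vec (Loop (tail G a))"
proof
  show "zigzag_mult (basis_vec (Arr a)) (basis_vec (Arr (opposite a))) x = basis_vec (Loop (tail G a)) x" for x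
  proof (cases x)
    case (Loop u)
    then show ?thesis
      by (simp only: mult_Arr_apply_Loop(1)[OF assms]) (simp add: basis_vec_apply)
  qed (simp_all add: basis_vec_apply)
qed

text \<open>Modulo inner derivations every derivation kills the vertex idempotents:
  \<open>w = \<Sum>\<^sub>u e\<^sub>u D(e\<^sub>u)\<close> satisfies \<open>D(e\<^sub>u) = e\<^sub>u w - w e\<^sub>u\<close>.\<close>

lemma derivation_on_vertices:
  fixes D :: "(('a, 'b) zigzag_basis \<Rightarrow> 'k::field) \<Rightarrow> ('a, 'b) zigzag_basis \<Rightarrow> 'k"
  assumes D: "is_derivation coord_algebra D"
  obtains w where "w \<in> carrier coord_algebra"
    and "\<And>u. u \<in> verts G \<Longrightarrow> D (basis_vec (Vtx u)) =
      (\<lambda>x. zigzag_mult (basis_vec (Vtx u)) w x - zigzag_mult w (basis_vec (Vtx u)) x)"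
proof -
  note D = coord_derivationD[OF D]
  define source where "source = case_zigzag_basis (\<lambda>u. u) (tail G) (\<lambda>u. u)"
  \<comment> \<open>The coefficient of \<open>x\<close> in the sum of all e_u D(e_u) comes from the
    vertex where \<open>x\<close> starts.\<close>
  define w where "w x = (if x \<in> zigzag_basis then D (basis_vec (Vtx (source x))) x else 0)" for x
  \<comment> \<open>Serves to turn d = 2 d into d = 0 in every characteristic.\<close>
  have two_neq_one: "(2 :: 'k) \<noteq> 1" by (metis one_add_one add_cancel_right_right zero_neq_one)
  have cl: "basis_vec (Vtx u) \<in> carrier coord_algebra" if "u \<in> verts G" for u
    using that by (simp add: basis_vec_closed)
  \<comment> \<open>The Leibniz rule for e_u e_v, which is e_u or zero.\<close>
  have leib: "(if u = v then D (basis_vec (Vtx u)) x else 0) =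
      zigzag_mult (basis_vec (Vtx u)) (D (basis_vec (Vtx v))) x
      + zigzag_mult (D (basis_vec (Vtx u))) (basis_vec (Vtx v)) x"
    if "u \<in> verts G" "v \<in> verts G" for u v x
    using D(4)[OF cl[OF that(1)] cl[OF that(2)]] D(3)[OF cl[OF that(1)], of 0]
    by (auto simp: mult_Vtx_Vtx fun_eq_iff split: if_splits)
  show ?thesis
  proof (rule that)
    show "w \<in> carrier coord_algebra" by (simp add: coord_algebra_simps w_def)
    fix u assume u: "u \<in> verts G"
    show "D (basis_vec (Vtx u)) =
      (\<lambda>x. zigzag_mult (basis_vec (Vtx u)) w x - zigzag_mult w (basis_vec (Vtx u)) x)"
    proof
      fix x
      show "D (basis_vec (Vtx u)) x = zigzag_mult (basis_vec (Vtx u)) w x - zigzag_mult w (basis_vec (Vtx u)) x"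
      proof (cases "x \<in> zigzag_basis")
        case False
        then show ?thesis using D(1)[OF cl[OF u] False]
          by (auto simp: mult_Vtx_apply w_def split: zigzag_basis.split)
      next
        case True
        show ?thesis
        proof (cases x)
          case (Vtx v)
          then show ?thesis using leib[OF u u, of x] two_neq_one
            by (auto simp: mult_Vtx_apply simp del: zigzag_mult_simps split: if_splits)
        next
          case (Loop v)
          then show ?thesis using leib[OF u u, of x] two_neq_one
            by (auto simp: mult_Vtx_apply simp del: zigzag_mult_simps split: if_splits)
        next
          case (Arr a)
          then have a: "a \<in> arcs G" using True by simp
          \<comment> \<open>If \<open>a\<close> starts at u, this is the definition of
            \<open>w\<close>. If it ends at u, the idempotent at its tail times e_u is zero, and
            Leibniz supplies the minus sign. Otherwise e_u e_u = e_u forces the coefficient to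
            vanish.\<close>
          then show ?thesis
            using leib[OF u u, of x] leib[of "tail G a" u x] u no_loops[OF a]
            by (auto simp: Arr mult_Vtx_apply w_def source_def add_eq_0_iff2 simp del: zigzag_mult_simps
                split: if_splits)
        qed
      qed
    qed
  qed
qed

text \<open>Killing the e_u makes \<open>D\<close> commute with the Peirce projections, so D(a)
  involves only basis elements from the tail to the head of \<open>a\<close>. Without loops and
  multiple arcs this leaves \<open>a\<close> itself. The value on l_u follows by Leibniz from the
  product of \<open>a\<close> and its opposite.\<close>

lemma derivation_killing_vertices:
  fixes D :: "(('a, 'b) zigzag_basis \<Rightarrow> 'k::field) \<Rightarrow> ('a, 'b) zigzag_basis \<Rightarrow> 'k"
  assumes D: "is_derivation coord_algebra D"
    and kill: "\<And>u. u \<in> verts G \<Longrightarrow> D (basis_vec (Vtx u)) = (\<lambda>_. 0)"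
    and a: "a \<in> arcs G"
  shows "D (basis_vec (Arr a)) = (\<lambda>x. D (basis_vec (Arr a)) (Arr a) * basis_vec (Arr a) x)"
    and "D (basis_vec (Loop (tail G a))) = (\<lambda>x.
      (D (basis_vec (Arr a)) (Arr a) + D (basis_vec (Arr (opposite a))) (Arr (opposite a)))
        * basis_vec (Loop (tail G a)) x)"
proof -
  note D' = coord_derivationD[OF D]
  have cl: "basis_vec (Arr a) \<in> carrier coord_algebra" "basis_vec (Vtx (tail G a)) \<in> carrier coord_algebra"
    "basis_vec (Vtx (head G a)) \<in> carrier coord_algebra"
    if "a \<in> arcs G" for a
    using that by (auto simp: basis_vec_closed)
  have zero: "zigzag_mult (\<lambda>_. 0) g x = 0" "zigzag_mult g (\<lambda>_. 0) x = 0" for g :: "('a, 'b) zigzag_basis \<Rightarrow> 'k" and x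
    by (cases x; simp)+
  have arr: "D (basis_vec (Arr a)) = (\<lambda>x. D (basis_vec (Arr a)) (Arr a) * basis_vec (Arr a) x)"
    if a: "a \<in> arcs G" for a
  proof
    fix x
    let ?d = "D (basis_vec (Arr a))"
    have t: "?d x = zigzag_mult (basis_vec (Vtx (tail G a))) ?d x"
      using D'(4)[OF cl(2,1)[OF a]] kill[OF tail_in_verts[OF a]] by (simp add: mult_Vtx_Arr zero)
    have h: "?d x = zigzag_mult ?d (basis_vec (Vtx (head G a))) x"
      using D'(4)[OF cl(1,3)[OF a]] kill[OF head_in_verts[OF a]] by (simp add: mult_Vtx_Arr zero)
    show "?d x = ?d (Arr a) * basis_vec (Arr a) x"
    proof (cases "x \<in> zigzag_basis")
      case False
      then show ?thesis using D'(1)[OF cl(1)[OF a] False] a by (auto simp: basis_vec_apply)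
    next
      case True
      show ?thesis
      proof (cases x)
        case (Arr b)
        then show ?thesis using True t h arc_eqI[OF a, of b]
          by (auto simp: mult_Vtx_apply basis_vec_apply simp del: zigzag_mult_simps split: if_splits)
      qed (use t h no_loops[OF a] in
          \<open>auto simp: mult_Vtx_apply basis_vec_apply simp del: zigzag_mult_simps split: if_splits\<close>)
    qed
  qed
  then show "D (basis_vec (Arr a)) = (\<lambda>x. D (basis_vec (Arr a)) (Arr a) * basis_vec (Arr a) x)"
    using a by blast
  have "D (basis_vec (Loop (tail G a))) = (\<lambda>x. zigzag_mult (basis_vec (Arr a)) (D (basis_vec (Arr (opposite a)))) x
      + zigzag_mult (D (basis_vec (Arr a))) (basis_vec (Arr (opposite a))) x)"
    using D'(4)[OF cl(1)[OF a] cl(1)[OF opposite_in_arcs[OF a]]] by (simp add: mult_Arr_Arr a)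
  also have "\<dots> = (\<lambda>x.
      (D (basis_vec (Arr a)) (Arr a) + D (basis_vec (Arr (opposite a))) (Arr (opposite a)))
        * basis_vec (Loop (tail G a)) x)"
  proof
    fix x
    show "zigzag_mult (basis_vec (Arr a)) (D (basis_vec (Arr (opposite a)))) x
      + zigzag_mult (D (basis_vec (Arr a))) (basis_vec (Arr (opposite a))) x =
      (D (basis_vec (Arr a)) (Arr a) + D (basis_vec (Arr (opposite a))) (Arr (opposite a)))
        * basis_vec (Loop (tail G a)) x"
    proof (cases x)
      case (Loop u)
      then show ?thesis by (simp only: Loop mult_Arr_apply_Loop[OF a]) (simp add: basis_vec_apply)
    qed (subst (1 2) arr[OF opposite_in_arcs[OF a]], subst arr[OF a], simp add: basis_vec_apply)+
  qed
  finally show "D (basis_vec (Loop (tail G a))) = \<dots>" .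
qed

section \<open>Characterisation of inner derivations and existence of an outer one\<close>

lemma inner_derivation_iff:
  fixes D :: "(('a, 'b) zigzag_basis \<Rightarrow> 'k::field) \<Rightarrow> ('a, 'b) zigzag_basis \<Rightarrow> 'k"
  assumes conn: "connected G" and "acyclic_graph G" and card: "card (verts G) > 1"
    and r: "r \<in> verts G" and D: "is_derivation coord_algebra D"
  shows "is_inner coord_algebra D \<longleftrightarrow> D (basis_vec (Loop r)) (Loop r) = 0"
proof
  have Lr: "basis_vec (Loop r) \<in> carrier coord_algebra" using r by (simp add: basis_vec_closed)
  \<comment> \<open>Both sides are the coefficient of e_r in \<open>w\<close>, so the commutator of
    l_r with \<open>w\<close> has no l_r coordinate.\<close>
  have comm_Loop: "zigzag_mult (basis_vec (Loop r)) w (Loop r) = zigzag_mult w (basis_vec (Loop r)) (Loop r)"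
    for w :: "('a, 'b) zigzag_basis \<Rightarrow> 'k"
    by (simp add: basis_vec_apply)
  show "D (basis_vec (Loop r)) (Loop r) = 0" if "is_inner coord_algebra D"
    using that Lr comm_Loop unfolding coord_is_inner_iff by auto
  assume zero: "D (basis_vec (Loop r)) (Loop r) = 0"
  interpret B: k_algebra "coord_algebra :: ('k, ('a, 'b) zigzag_basis \<Rightarrow> 'k) module" by (rule k_algebra_coord)
  obtain w where w: "w \<in> carrier coord_algebra"
    and vert: "\<And>u. u \<in> verts G \<Longrightarrow> D (basis_vec (Vtx u)) =
      (\<lambda>x. zigzag_mult (basis_vec (Vtx u)) w x - zigzag_mult w (basis_vec (Vtx u)) x)"
    using derivation_on_vertices[OF D] by blast
  define D' where "D' f x = D f x - (zigzag_mult f w x - zigzag_mult w f x)" for f x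
  have D': "is_derivation coord_algebra D'"
    unfolding D'_def by (rule derivation_diff_commutator[OF D w])
  have D'_vert: "D' (basis_vec (Vtx u)) = (\<lambda>_. 0)" if "u \<in> verts G" for u
    using vert[OF that] by (simp add: D'_def fun_eq_iff)
  define c where "c a = D' (basis_vec (Arr a)) (Arr a)" for a
  have arr: "D' (basis_vec (Arr a)) = (\<lambda>x. c a * basis_vec (Arr a) x)" if "a \<in> arcs G" for a
    unfolding c_def by (rule derivation_killing_vertices(1)[OF D' D'_vert that])
  have loop: "D' (basis_vec (Loop (tail G a))) = (\<lambda>x. (c a + c (opposite a)) * basis_vec (Loop (tail G a)) x)"
    if "a \<in> arcs G" for a
    unfolding c_def by (rule derivation_killing_vertices(2)[OF D' D'_vert that])
  define s where "s u = D' (basis_vec (Loop u)) (Loop u)" for u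
  have s: "s (tail G a) = c a + c (opposite a)" if "a \<in> arcs G" for a
    using loop[OF that] by (simp add: s_def basis_vec_apply)
  \<comment> \<open>The scalar is symmetric in \<open>a\<close> and its opposite, which starts at
    the head of \<open>a\<close>.\<close>
  have "s (tail G a) = s (head G a)" if "a \<in> arcs G" for a
    using s[OF that] s[OF opposite_in_arcs[OF that]] that by (simp add: add.commute)
  \<comment> \<open>By \<open>comm_Loop\<close>, subtracting the commutator with \<open>w\<close>
    has not changed this coordinate.\<close>
  moreover have "s r = 0" using zero comm_Loop by (simp add: s_def D'_def)
  ultimately have s0: "s u = 0" if "u \<in> verts G" for u
    using connected_constant[OF conn, of s u r] that r by simp
  then have anti: "c a + c (opposite a) = 0" if "a \<in> arcs G" for a
    using s[OF that] that by simp
  obtain p where p: "\<And>a. a \<in> arcs G \<Longrightarrow> c a = p (head G a) - p (tail G a)"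
    using antisymmetric_imp_gradient[OF assms(2) conn, of c] anti by blast
  \<comment> \<open>The sum of all p_u e_u. Its commutator multiplies each arrow by the value of
    \<open>p\<close> at the head minus that at the tail, and vanishes on e_u and l_u.\<close>
  define w' where "w' x = (case x of Vtx u \<Rightarrow> if u \<in> verts G then p u else 0 | _ \<Rightarrow> 0)" for x :: "('a, 'b) zigzag_basis"
  have w': "w' \<in> carrier coord_algebra"
    by (auto simp: coord_algebra_simps w'_def split: zigzag_basis.split)
  define D'' where "D'' f x = D' f x - (zigzag_mult f w' x - zigzag_mult w' f x)" for f x
  have D'': "is_derivation coord_algebra D''"
    unfolding D''_def by (rule derivation_diff_commutator[OF D' w'])
  have basis0: "D'' (basis_vec x) y = 0" if x: "x \<in> zigzag_basis" for x y
  proof (cases x)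
    case (Vtx u)
    then show ?thesis using x D'_vert[of u]
      by (auto simp: D''_def mult_Vtx_apply w'_def split: zigzag_basis.split)
  next
    case (Arr a)
    then show ?thesis using x arr[of a] p[of a]
      by (cases y) (auto simp: D''_def w'_def basis_vec_apply algebra_simps)
  next
    case (Loop u)
    \<comment> \<open>The value on l_u is computed from an arrow leaving u, which must therefore
      exist.\<close>
    then have "out_arcs G u \<noteq> {}" using connected_out_arcs[OF conn card] x by simp
    then obtain a where a: "a \<in> arcs G" "tail G a = u" unfolding out_arcs_def by blast
    have "D' (basis_vec (Loop u)) y = 0" using loop[OF a(1)] anti[OF a(1)] a(2) by simp
    then show ?thesis using Loop
      by (cases y) (auto simp: D''_def w'_def basis_vec_apply)
  qed
  have "D'' f = (\<lambda>_. 0)" if "f \<in> carrier coord_algebra" for f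
    by (rule derivation_zero_on_basis[OF D'' _ that]) (use basis0 in blast)
  then have eq: "D f = (\<lambda>x. (zigzag_mult f w x - zigzag_mult w f x) + (zigzag_mult f w' x - zigzag_mult w' f x))"
    if "f \<in> carrier coord_algebra" for f
    using that by (auto simp: D''_def D'_def fun_eq_iff algebra_simps)
  have "is_inner coord_algebra (\<lambda>f x. (zigzag_mult f w x - zigzag_mult w f x) + (zigzag_mult f w' x - zigzag_mult w' f x))"
    using B.inner_add[OF commutator_derivation(2)[OF w] commutator_derivation(2)[OF w']]
    by (simp add: coord_algebra_simps)
  then show "is_inner coord_algebra D"
    by (subst is_inner_cong[OF eq])
qed

lemma outer_derivation_exists:
  assumes r: "r \<in> verts G"
  obtains D :: "(('a, 'b) zigzag_basis \<Rightarrow> 'k::field) \<Rightarrow> ('a, 'b) zigzag_basis \<Rightarrow> 'k"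
  where "is_derivation coord_algebra D" and "D (basis_vec (Loop r)) (Loop r) = 1"
proof -
  \<comment> \<open>Numbering the vertices orients every edge towards its larger end. By
    injectivity, exactly one of two opposite arcs receives the weight one.\<close>
  obtain n :: "'a \<Rightarrow> nat" where n: "inj_on n (verts G)"
    using finite_imp_inj_to_nat_seg[OF finite_verts] by blast
  define c :: "'b \<Rightarrow> 'k" where "c a = (if n (tail G a) < n (head G a) then 1 else 0)" for a
  have c: "c a + c (opposite a) = 1" if a: "a \<in> arcs G" for a
    using inj_onD[OF n, of "tail G a" "head G a"] no_loops[OF a] a by (auto simp: c_def)
  define D :: "(('a, 'b) zigzag_basis \<Rightarrow> 'k) \<Rightarrow> ('a, 'b) zigzag_basis \<Rightarrow> 'k"
    where "D f x = (case x of Vtx u \<Rightarrow> 0 | Arr a \<Rightarrow> c a * f x | Loop u \<Rightarrow> f x)" for f x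
  have "D (zigzag_mult f g) x = zigzag_mult f (D g) x + zigzag_mult (D f) g x" for f g x
  proof (cases x)
    case (Loop u)
    \<comment> \<open>The factor one on l_u is split as \<open>c a + c (opposite a)\<close>, one
      part for each arrow in the product.\<close>
    have "(\<Sum>a\<in>out_arcs G u. f (Arr a) * g (Arr (opposite a))) =
      (\<Sum>a\<in>out_arcs G u. f (Arr a) * (c (opposite a) * g (Arr (opposite a)))
        + c a * f (Arr a) * g (Arr (opposite a)))"
    proof (rule sum.cong)
      fix a assume "a \<in> out_arcs G u"
      then have "f (Arr a) * g (Arr (opposite a)) = (c a + c (opposite a)) * (f (Arr a) * g (Arr (opposite a)))"
        using c by simp
      then show "f (Arr a) * g (Arr (opposite a)) = f (Arr a) * (c (opposite a) * g (Arr (opposite a)))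
        + c a * f (Arr a) * g (Arr (opposite a))" by (simp add: algebra_simps)
    qed simp
    then show ?thesis by (simp add: Loop D_def sum.distrib)
  qed (simp_all add: D_def algebra_simps)
  then have "is_derivation coord_algebra D"
    unfolding is_derivation_def
    by (auto simp: coord_algebra_simps D_def algebra_simps split: zigzag_basis.split)
  moreover have "D (basis_vec (Loop r)) (Loop r) = 1" by (simp add: D_def basis_vec_apply)
  ultimately show ?thesis by (rule that)
qed

end

section \<open>The zigzag algebra in coordinates\<close>

context graph
begin

text \<open>The coefficients of the 2-cycles at u are added up because the relations identify these
  cycles; paths that become zero in the quotient are dropped.\<close>

definition coords :: "('a \<times> 'b list \<Rightarrow> 'k::field) \<Rightarrow> ('a, 'b) zigzag_basis \<Rightarrow> 'k"
  where "coords f x = (case x of Vtx u \<Rightarrow> f (u, []) | Arr a \<Rightarrow> f (tail G a, [a])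
    | Loop u \<Rightarrow> \<Sum>a\<in>out_arcs G u. f (u, [a, opposite a]))"

lemma coords_simps [simp]:
  "coords f (Vtx u) = f (u, [])" "coords f (Arr a) = f (tail G a, [a])"
  "coords f (Loop u) = (\<Sum>a\<in>out_arcs G u. f (u, [a, opposite a]))"
  by (simp_all add: coords_def)

lemma path_algebra_simps:
  "f \<in> carrier (path_algebra G) \<longleftrightarrow> finite {x. f x \<noteq> 0} \<and> {x. f x \<noteq> 0} \<subseteq> quiver_paths G"
  "one (path_algebra G) = (\<lambda>(u, p). if u \<in> verts G \<and> p = [] then 1 else 0)"
  "zero (path_algebra G) = (\<lambda>_. 0)"
  "add (path_algebra G) = (\<lambda>f g x. f x + g x)"
  "smult (path_algebra G) = (\<lambda>k f x. k * f x)"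
  by (simp_all add: path_algebra_def)

lemma path_algebra_mult:
  "(f \<otimes>\<^bsub>path_algebra G\<^esub> g) (u, p) =
    (\<Sum>i\<le>length p. f (u, take i p) * g (awlast u (take i p), drop i p))"
  by (simp add: path_algebra_def)

lemma quiver_paths_iff: "(u, p) \<in> quiver_paths G \<longleftrightarrow> awalk u p (awlast u p)"
  unfolding quiver_paths_def by auto

lemma module_path_algebra:
  "Module.module (class_ring :: 'k::field ring) (path_algebra G :: ('k, 'a \<times> 'b list \<Rightarrow> 'k) module)"
    (is "Module.module _ ?P")
proof (rule moduleI)
  interpret ring ?P by (rule path_algebra_ring) unfold_locales
  show "abelian_group ?P" by unfold_locales
  show "cring (class_ring :: 'k ring)" by (rule class_cring.cring_axioms)
  fix k f assume "f \<in> carrier ?P"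
  moreover have "{x. k * f x \<noteq> 0} \<subseteq> {x. f x \<noteq> 0}" by auto
  ultimately show "k \<odot>\<^bsub>?P\<^esub> f \<in> carrier ?P"
    unfolding path_algebra_simps by (meson finite_subset order_trans)
qed (auto simp: path_algebra_simps algebra_simps)

lemma path_algebra_minus:
  assumes "f \<in> carrier (path_algebra G)" "g \<in> carrier (path_algebra G)"
  shows "(f :: 'a \<times> 'b list \<Rightarrow> 'k::field) \<ominus>\<^bsub>path_algebra G\<^esub> g = (\<lambda>x. f x - g x)"
proof -
  let ?P = "path_algebra G :: ('k, 'a \<times> 'b list \<Rightarrow> 'k) module"
  interpret P: ring ?P by (rule path_algebra_ring) unfold_locales
  have eq: "(f \<ominus>\<^bsub>?P\<^esub> g) \<oplus>\<^bsub>?P\<^esub> g = f"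
    using assms by (simp add: P.minus_eq P.a_assoc P.l_neg)
  have "(f \<ominus>\<^bsub>?P\<^esub> g) x + g x = f x" for x
    using fun_cong[OF eq, of x] by (simp add: path_algebra_simps(4))
  then show ?thesis by (intro ext) (simp add: eq_diff_eq)
qed

lemma path_elem_closed: "x \<in> quiver_paths G \<Longrightarrow> path_elem x \<in> carrier (path_algebra G)"
  by (auto simp: path_algebra_simps path_elem_def)

lemma coords_closed: "f \<in> carrier (path_algebra G) \<Longrightarrow> coords f \<in> carrier coord_algebra"
proof -
  assume f: "f \<in> carrier (path_algebra G)"
  have "f (u, p) = 0" if "\<not> awalk u p (awlast u p)" for u p
    using f that unfolding path_algebra_simps quiver_paths_iff[symmetric] by auto
  then have "coords f x = 0" if "x \<notin> zigzag_basis" for x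
    using that by (cases x) (auto simp: out_arcs_outside awalk_Cons_iff awalk_Nil_iff)
  then show ?thesis by (simp add: coord_algebra_simps)
qed

lemma coords_add: "coords (\<lambda>x. f x + g x) = (\<lambda>x. coords f x + coords g x)"
  by (rule ext, case_tac x) (simp_all add: sum.distrib)

lemma coords_smult: "coords (\<lambda>x. k * f x) = (\<lambda>x. k * coords f x)"
  by (rule ext, case_tac x) (simp_all add: sum_distrib_left)

text \<open>Cutting a path gives no longer pieces, so these coordinates of a product need only short
  paths. The three cuts of a 2-cycle give the three kinds of summands at
  \<open>Loop u\<close>.\<close>

lemma coords_mult:
  "coords (f \<otimes>\<^bsub>path_algebra G\<^esub> g) = zigzag_mult (coords f) (coords g)"
proof
  fix x
  show "coords (f \<otimes>\<^bsub>path_algebra G\<^esub> g) x = zigzag_mult (coords f) (coords g) x"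
  proof (cases x)
    case (Loop u)
    have "(f \<otimes>\<^bsub>path_algebra G\<^esub> g) (u, [a, opposite a]) =
        f (u, []) * g (u, [a, opposite a]) + f (u, [a, opposite a]) * g (u, [])
        + f (tail G a, [a]) * g (tail G (opposite a), [opposite a])"
      if "a \<in> out_arcs G u" for a
      using that by (auto simp: path_algebra_mult atMost_Suc numeral_2_eq_2 algebra_simps)
    then show ?thesis
      by (simp add: Loop sum.distrib sum_distrib_left sum_distrib_right)
  qed (simp_all add: path_algebra_mult atMost_Suc algebra_simps)
qed

lemma coords_image:
  assumes "\<And>u. u \<in> verts G \<Longrightarrow> out_arcs G u \<noteq> {}"
  shows "coords ` carrier (path_algebra G) =
    carrier (coord_algebra :: ('k::field, ('a, 'b) zigzag_basis \<Rightarrow> 'k) module)"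
proof (intro equalityI subsetI)
  fix h :: "('a, 'b) zigzag_basis \<Rightarrow> 'k" assume "h \<in> carrier coord_algebra"
  then have h: "h x = 0" if "x \<notin> zigzag_basis" for x
    using that by (simp add: coord_algebra_simps)
  \<comment> \<open>A chosen 2-cycle at each vertex is to carry the whole coordinate at
    \<open>Loop u\<close>.\<close>
  define s where "s u = (SOME a. a \<in> out_arcs G u)" for u
  have s: "s u \<in> out_arcs G u" if "u \<in> verts G" for u
    unfolding s_def some_in_eq by (rule assms[OF that])
  define f :: "'a \<times> 'b list \<Rightarrow> 'k" where "f = (\<lambda>(u, p).
    if p = [] then h (Vtx u)
    else if p = [hd p] \<and> tail G (hd p) = u then h (Arr (hd p))
    else if p = [s u, opposite (s u)] then h (Loop u) else 0)"
  have supp: "{x. f x \<noteq> 0} \<subseteq> (\<lambda>u. (u, [])) ` verts G \<union> (\<lambda>a. (tail G a, [a])) ` arcs G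
      \<union> (\<lambda>u. (u, [s u, opposite (s u)])) ` verts G" (is "_ \<subseteq> ?S")
  proof
    fix x assume "x \<in> {x. f x \<noteq> 0}"
    then obtain u p where x: "x = (u, p)" "f (u, p) \<noteq> 0" by (cases x) auto
    then consider "p = []" "h (Vtx u) \<noteq> 0" | a where "p = [a]" "tail G a = u" "h (Arr a) \<noteq> 0"
      | "p = [s u, opposite (s u)]" "h (Loop u) \<noteq> 0"
      by (auto simp: f_def split: if_splits)
    then show "x \<in> ?S"
      by cases (use h x(1) zigzag_basis_iff in \<open>blast+\<close>)
  qed
  moreover have "?S \<subseteq> quiver_paths G"
    using s by (auto simp: quiver_paths_iff awalk_Cons_iff awalk_Nil_iff)
  moreover have "finite ?S" by simp
  ultimately have "f \<in> carrier (path_algebra G)"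
    unfolding path_algebra_simps by (meson finite_subset order_trans)
  moreover have "coords f = h"
  proof
    fix x
    show "coords f x = h x"
    proof (cases x)
      case (Loop u)
      have "coords f x = (\<Sum>a\<in>out_arcs G u. if a = s u then h (Loop u) else 0)"
        unfolding Loop coords_simps by (rule sum.cong) (auto simp: f_def)
      also have "\<dots> = h (Loop u)"
        using s[of u] h[of "Loop u"] sum_out_arcs_delta[of "s u" "\<lambda>_. h (Loop u)" u]
        by (cases "u \<in> verts G") (auto simp: out_arcs_outside)
      finally show ?thesis using Loop by simp
    qed (simp_all add: f_def)
  qed
  ultimately show "h \<in> coords ` carrier (path_algebra G)" by blast
qed (auto intro: coords_closed)

lemma coords_epimorphism:
  assumes "\<And>u. u \<in> verts G \<Longrightarrow> out_arcs G u \<noteq> {}"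
  shows "module_epimorphism (class_ring :: 'k::field ring) (path_algebra G)
    (coord_algebra :: ('k, ('a, 'b) zigzag_basis \<Rightarrow> 'k) module) coords"
proof -
  interpret B: k_algebra "coord_algebra :: ('k, ('a, 'b) zigzag_basis \<Rightarrow> 'k) module" by (rule k_algebra_coord)
  show ?thesis
    by (intro module_epimorphism.intro module_epimorphism_axioms.intro module_path_algebra
        B.module_axioms coords_image assms)
      (simp_all add: path_algebra_simps coord_algebra_simps coords_add coords_smult)
qed

lemma coords_ring_hom:
  "ring_hom_ring (path_algebra G) (coord_algebra :: ('k::field, ('a, 'b) zigzag_basis \<Rightarrow> 'k) module) coords"
proof -
  interpret B: k_algebra "coord_algebra :: ('k, ('a, 'b) zigzag_basis \<Rightarrow> 'k) module" by (rule k_algebra_coord)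
  have "coords \<one>\<^bsub>path_algebra G\<^esub> = (\<one>\<^bsub>coord_algebra\<^esub> :: ('a, 'b) zigzag_basis \<Rightarrow> 'k)"
    by (rule ext, case_tac x) (simp_all add: path_algebra_simps coord_algebra_def)
  then have "coords \<in> Ring.ring_hom (path_algebra G) (coord_algebra :: ('k, ('a, 'b) zigzag_basis \<Rightarrow> 'k) module)"
    by (intro ring_hom_memI)
      (simp_all add: coords_closed coords_mult path_algebra_simps coord_algebra_simps coords_add
        del: coords_simps flip: coord_algebra_simps(1) path_algebra_simps(1))
  then show ?thesis
    by (intro ring_hom_ringI2 path_algebra_ring B.ring_axioms) unfold_locales
qed

section \<open>The kernel of \<open>coords\<close> is the zigzag ideal\<close>

lemma coords_long_path:
  assumes "3 \<le> length p \<or> length p = 2 \<and> v \<noteq> u" "awalk u p v"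
  shows "coords (path_elem (u, p) :: 'a \<times> 'b list \<Rightarrow> 'k::field) = (\<lambda>_. 0)"
proof
  fix x
  \<comment> \<open>Beyond trivial paths and arrows, \<open>coords\<close> reads only 2-cycles,
    which are excluded here by the length or by the endpoints.\<close>
  have "(w, [a, opposite a]) \<noteq> (u, p)" if "a \<in> out_arcs G w" for a w
    using assms that by (auto simp: awalk_Cons_iff awalk_Nil_iff)
  then show "coords (path_elem (u, p) :: 'a \<times> 'b list \<Rightarrow> 'k) x = 0"
    using assms by (cases x) (auto simp: path_elem_def intro!: sum.neutral)
qed

lemma coords_two_cycle:
  assumes "a \<in> arcs G"
  shows "coords (path_elem (tail G a, [a, opposite a]) :: 'a \<times> 'b list \<Rightarrow> 'k::field) = basis_vec (Loop (tail G a))"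
proof
  fix x
  show "coords (path_elem (tail G a, [a, opposite a])) x = (basis_vec (Loop (tail G a)) x :: 'k)"
  proof (cases x)
    case (Loop u)
    have "(\<Sum>b\<in>out_arcs G u. path_elem (tail G a, [a, opposite a]) (u, [b, opposite b]))
        = (\<Sum>b\<in>out_arcs G u. if b = a then 1 else 0 :: 'k)"
      by (rule sum.cong) (auto simp: path_elem_def)
    then show ?thesis using Loop assms by (simp add: sum_out_arcs_delta basis_vec_apply)
  qed (simp_all add: path_elem_def basis_vec_apply)
qed

lemma closed_two_walk:
  assumes "awalk u p u" "length p = 2"
  obtains a where "a \<in> arcs G" "tail G a = u" "p = [a, opposite a]"
proof -
  obtain a b where "p = [a, b]" using assms(2) by (auto simp: length_Suc_conv numeral_2_eq_2)
  then show ?thesis using assms(1) awalk_two_iff that by simp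
qed

lemma zigzag_relations_in_kernel:
  assumes "x \<in> (zigzag_relations G :: ('a \<times> 'b list \<Rightarrow> 'k::field) set)"
  shows "x \<in> carrier (path_algebra G)" and "coords x = (\<lambda>_. 0)"
proof -
  let ?P = "path_algebra G :: ('k, 'a \<times> 'b list \<Rightarrow> 'k) module"
  interpret P: ring ?P by (rule path_algebra_ring) unfold_locales
  have cl: "(path_elem (u, p) :: _ \<Rightarrow> 'k) \<in> carrier ?P" if "awalk u p v" for u p v
    using that by (intro path_elem_closed) (auto simp: quiver_paths_def)
  consider u p v where "x = path_elem (u, p)" "awalk u p v" "3 \<le> length p \<or> length p = 2 \<and> v \<noteq> u"
    | u p q where "x = path_elem (u, p) \<ominus>\<^bsub>?P\<^esub> path_elem (u, q)"
      "awalk u p u" "length p = 2" "awalk u q u" "length q = 2"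
    using assms unfolding zigzag_relations_def by blast
  then have "x \<in> carrier ?P \<and> coords x = (\<lambda>_. 0)"
  proof cases
    case 1
    then show ?thesis using cl coords_long_path by blast
  next
    case 2
    have "x = (\<lambda>y. path_elem (u, p) y + (-1) * path_elem (u, q) y)"
      using 2 cl by (simp add: path_algebra_minus)
    then have "coords x = (\<lambda>y. coords (path_elem (u, p)) y + (-1) * coords (path_elem (u, q)) y)"
      by (simp only: coords_add coords_smult)
    also obtain a where "a \<in> arcs G" "tail G a = u" "p = [a, opposite a]" using closed_two_walk 2 by blast
    then have "coords (path_elem (u, p)) = (basis_vec (Loop u) :: _ \<Rightarrow> 'k)" using coords_two_cycle by blast
    also obtain b where "b \<in> arcs G" "tail G b = u" "q = [b, opposite b]" using closed_two_walk 2 by blast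
    then have "coords (path_elem (u, q)) = (basis_vec (Loop u) :: _ \<Rightarrow> 'k)" using coords_two_cycle by blast
    finally show ?thesis using 2 cl by simp
  qed
  then show "x \<in> carrier ?P" "coords x = (\<lambda>_. 0)" by blast+
qed

text \<open>An ideal is closed under ring multiplication; scalars are brought in by multiplying with
  scalar multiples of the unit.\<close>

lemma ideal_combination_closed:
  assumes I: "ideal I (path_algebra G :: ('k::field, 'a \<times> 'b list \<Rightarrow> 'k) module)"
    and "finite S" and "\<And>s. s \<in> S \<Longrightarrow> r s \<in> I"
  shows "(\<lambda>y. \<Sum>s\<in>S. c s * r s y) \<in> I"
  using assms(2,3)
proof (induction S)
  let ?P = "path_algebra G :: ('k, 'a \<times> 'b list \<Rightarrow> 'k) module"
  interpret I: ideal I ?P by fact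
  interpret M: Module.module "class_ring :: 'k ring" ?P by (rule module_path_algebra)
  {
    case empty
    show ?case using additive_subgroup.zero_closed[OF I.is_additive_subgroup] by (simp add: path_algebra_simps)
  next
    case (insert s S)
    have "(\<lambda>y. c s * r s y) = (c s \<odot>\<^bsub>?P\<^esub> \<one>\<^bsub>?P\<^esub>) \<otimes>\<^bsub>?P\<^esub> r s"
    proof
      fix y
      have "r s \<in> carrier ?P" using insert.prems I.Icarr by blast
      then have "c s * (\<one>\<^bsub>?P\<^esub> \<otimes>\<^bsub>?P\<^esub> r s) y = c s * r s y" by simp
      moreover have "((c s \<odot>\<^bsub>?P\<^esub> \<one>\<^bsub>?P\<^esub>) \<otimes>\<^bsub>?P\<^esub> r s) y = c s * (\<one>\<^bsub>?P\<^esub> \<otimes>\<^bsub>?P\<^esub> r s) y"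
        by (cases y) (simp add: path_algebra_mult path_algebra_simps(5) sum_distrib_left mult.assoc)
      ultimately show "c s * r s y = ((c s \<odot>\<^bsub>?P\<^esub> \<one>\<^bsub>?P\<^esub>) \<otimes>\<^bsub>?P\<^esub> r s) y" by (simp only:)
    qed
    moreover have "c s \<odot>\<^bsub>?P\<^esub> \<one>\<^bsub>?P\<^esub> \<in> carrier ?P" by simp
    ultimately have "(\<lambda>y. c s * r s y) \<in> I"
      using insert.prems I.I_l_closed by simp
    moreover have "(\<lambda>y. \<Sum>s\<in>S. c s * r s y) \<in> I" using insert by simp
    ultimately show ?case
      using insert.hyps additive_subgroup.a_closed[OF I.is_additive_subgroup, of "\<lambda>y. c s * r s y" "\<lambda>y. \<Sum>s\<in>S. c s * r s y"]
      by (simp add: path_algebra_simps(4))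
  }
qed

text \<open>Subtracting from every 2-cycle at \<open>u\<close> a chosen one \<open>b u\<close> does not change an element of
  the kernel of \<^term>\<open>coords\<close>, because the coefficients of the 2-cycles at \<open>u\<close> add up to zero.\<close>

lemma coords_kernel_subset:
  assumes out: "\<And>u. u \<in> verts G \<Longrightarrow> out_arcs G u \<noteq> {}"
    and f: "f \<in> carrier (path_algebra G)" and ker: "coords f = (\<lambda>_. 0 :: 'k::field)"
  shows "f \<in> Idl\<^bsub>path_algebra G\<^esub> (zigzag_relations G)"
proof -
  let ?P = "path_algebra G :: ('k, 'a \<times> 'b list \<Rightarrow> 'k) module"
  let ?R = "zigzag_relations G :: ('a \<times> 'b list \<Rightarrow> 'k) set"
  interpret P: ring ?P by (rule path_algebra_ring) unfold_locales
  have R: "?R \<subseteq> carrier ?P" using zigzag_relations_in_kernel(1) by blast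
  define t where "t u = (SOME a. a \<in> out_arcs G u)" for u
  have t: "t u \<in> out_arcs G u" if "u \<in> verts G" for u
    unfolding t_def some_in_eq by (rule out[OF that])
  define b where "b u = (u, [t u, opposite (t u)])" for u
  define cyc where "cyc x \<longleftrightarrow> (\<exists>a\<in>arcs G. x = (tail G a, [a, opposite a]))" for x
  define S where "S = {x. f x \<noteq> 0}"
  have S: "finite S" "S \<subseteq> quiver_paths G" using f by (simp_all add: S_def path_algebra_simps)
  \<comment> \<open>The relation attached to a path: the path itself, or its difference from the
    chosen 2-cycle at the same vertex if it is a 2-cycle.\<close>
  define r :: "'a \<times> 'b list \<Rightarrow> 'a \<times> 'b list \<Rightarrow> 'k"
    where "r x = (\<lambda>y. path_elem x y - (if cyc x then path_elem (b (fst x)) y else 0))" for x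
  have b: "awalk u [t u, opposite (t u)] u" if "u \<in> verts G" for u
    using t[OF that] by (simp add: awalk_two_iff)
  have "r x \<in> Idl\<^bsub>?P\<^esub> ?R" if x: "x \<in> S" for x
  proof -
    obtain u p where up: "x = (u, p)" by (cases x)
    have aw: "awalk u p (awlast u p)" using x S(2) up quiver_paths_iff by blast
    have u: "u \<in> verts G" using aw by auto
    have "r x \<in> ?R"
    proof (cases "cyc x")
      case True
      then obtain a where a: "a \<in> arcs G" "x = (tail G a, [a, opposite a])" by (auto simp: cyc_def)
      have "awalk u p u" "length p = 2" using a up by (auto simp: awalk_two_iff)
      moreover have "path_elem (u, p) \<in> carrier ?P" "path_elem (b u) \<in> carrier ?P"
        using aw b[OF u] by (auto intro!: path_elem_closed simp: quiver_paths_def b_def)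
      then have "r x = path_elem (u, p) \<ominus>\<^bsub>?P\<^esub> path_elem (u, [t u, opposite (t u)])"
        using True by (simp add: r_def up path_algebra_minus b_def)
      moreover have "length [t u, opposite (t u)] = 2" by simp
      ultimately show ?thesis unfolding zigzag_relations_def using b[OF u] by blast
    next
      case False
      then have r: "r x = path_elem (u, p)" by (simp add: r_def up)
      \<comment> \<open>An element of the kernel has no coefficients at trivial paths and arrows, so
        only paths occurring in the relations remain.\<close>
      have "p \<noteq> []" using x fun_cong[OF ker, of "Vtx u"] by (auto simp: S_def up)
      moreover have "p \<noteq> [a]" for a
        using x aw fun_cong[OF ker, of "Arr a"] by (auto simp: S_def up awalk_Cons_iff)
      ultimately have "3 \<le> length p \<or> length p = 2"
        by (cases p rule: remdups_adj.cases) (auto simp: Suc_le_eq)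
      moreover have "awlast u p \<noteq> u" if "length p = 2"
        using aw that False closed_two_walk[of u p] unfolding cyc_def up by metis
      ultimately show ?thesis unfolding zigzag_relations_def r using aw by blast
    qed
    then show ?thesis using P.genideal_self[OF R] by blast
  qed
  then have "(\<lambda>y. \<Sum>x\<in>S. f x * r x y) \<in> Idl\<^bsub>?P\<^esub> ?R"
    by (rule ideal_combination_closed[OF P.genideal_ideal[OF R] S(1)])
  moreover have "(\<lambda>y. \<Sum>x\<in>S. f x * r x y) = f"
  proof
    fix y
    have "(\<Sum>x\<in>S. f x * r x y) = (\<Sum>x\<in>S. if x = y then f x else 0)
        - (\<Sum>x\<in>S. if cyc x \<and> y = b (fst x) then f x else 0)"
      unfolding sum_subtractf[symmetric]
      by (rule sum.cong) (auto simp: r_def path_elem_def)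
    also have "(\<Sum>x\<in>S. if x = y then f x else 0) = f y"
      using S(1) by (simp add: S_def)
    \<comment> \<open>The chosen cycle at u collects the coefficients of all 2-cycles at u, whose
      sum is the vanishing coordinate at \<open>Loop u\<close>.\<close>
    also have "(\<Sum>x\<in>S. if cyc x \<and> y = b (fst x) then f x else 0) = 0"
    proof (cases "\<exists>u. y = b u")
      case False
      then show ?thesis by (intro sum.neutral) auto
    next
      case True
      then obtain u where y: "y = b u" by blast
      then have "(\<Sum>x\<in>S. if cyc x \<and> y = b (fst x) then f x else 0)
          = (\<Sum>x\<in>S. if cyc x \<and> fst x = u then f x else 0)"
        by (intro sum.cong) (auto simp: b_def)
      also have "\<dots> = (\<Sum>x\<in>{x\<in>S. cyc x \<and> fst x = u}. f x)"
        by (rule sum.inter_filter[OF S(1), symmetric])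
      \<comment> \<open>Cycles outside the support contribute zero, so the sum may run over all
        2-cycles at u.\<close>
      also have "\<dots> = (\<Sum>x\<in>(\<lambda>a. (u, [a, opposite a])) ` out_arcs G u. f x)"
        by (rule sum.mono_neutral_left) (auto simp: cyc_def S_def)
      also have "\<dots> = coords f (Loop u)"
        by (subst sum.reindex) (auto simp: inj_on_def)
      finally show ?thesis using ker by simp
    qed
    finally show "(\<Sum>x\<in>S. f x * r x y) = f y" by simp
  qed
  ultimately show ?thesis by simp
qed

lemma zigzag_ideal:
  assumes out: "\<And>u. u \<in> verts G \<Longrightarrow> out_arcs G u \<noteq> {}"
  shows "Idl\<^bsub>path_algebra G\<^esub> (zigzag_relations G) =
    {f \<in> carrier (path_algebra G). coords f = (\<lambda>_. 0 :: 'k::field)}"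
proof
  let ?P = "path_algebra G :: ('k, 'a \<times> 'b list \<Rightarrow> 'k) module"
  let ?J = "{f \<in> carrier ?P. coords f = (\<lambda>_. 0)}"
  interpret h: ring_hom_ring ?P coord_algebra coords by (rule coords_ring_hom)
  have "a_kernel ?P coord_algebra coords = ?J"
    unfolding a_kernel_def' coord_algebra_simps(3) ..
  then have "ideal ?J ?P" using h.kernel_is_ideal by simp
  moreover have "zigzag_relations G \<subseteq> ?J"
  proof
    fix x assume "x \<in> (zigzag_relations G :: ('a \<times> 'b list \<Rightarrow> 'k) set)"
    from zigzag_relations_in_kernel[OF this] show "x \<in> ?J" by simp
  qed
  ultimately show "Idl\<^bsub>?P\<^esub> (zigzag_relations G) \<subseteq> ?J"
    by (rule h.R.genideal_minimal)
  show "?J \<subseteq> Idl\<^bsub>?P\<^esub> (zigzag_relations G)"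
  proof
    fix f assume "f \<in> ?J"
    then show "f \<in> Idl\<^bsub>?P\<^esub> (zigzag_relations G)"
      by (intro coords_kernel_subset out) simp_all
  qed
qed

text \<open>The zigzag ideal is the kernel of \<open>coords\<close>, so coordinates correspond to
  the coset of all path algebra elements that have them.\<close>

lemma zigzag_algebra_iso:
  assumes out: "\<And>u. u \<in> verts G \<Longrightarrow> out_arcs G u \<noteq> {}"
  shows "\<exists>F. k_algebra_iso (coord_algebra :: ('k::field, ('a, 'b) zigzag_basis \<Rightarrow> 'k) module)
    (zigzag_algebra G) F"
proof -
  let ?P = "path_algebra G :: ('k, 'a \<times> 'b list \<Rightarrow> 'k) module"
  let ?B = "coord_algebra :: ('k, ('a, 'b) zigzag_basis \<Rightarrow> 'k) module"
  interpret h: ring_hom_ring ?P ?B coords by (rule coords_ring_hom)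
  interpret E: module_epimorphism "class_ring :: 'k ring" ?P ?B coords
    by (rule coords_epimorphism[OF out])
  have "Idl\<^bsub>?P\<^esub> (zigzag_relations G) = E.fibre \<zero>\<^bsub>?B\<^esub>"
    unfolding E.fibre_def coord_algebra_simps by (rule zigzag_ideal) (rule out)
  then have A: "zigzag_algebra G = E.Q" by (simp add: zigzag_algebra_def)
  have "E.fibre \<one>\<^bsub>?B\<^esub> = \<one>\<^bsub>E.Q\<^esub>"
    using E.rcoset[OF h.R.one_closed] by (simp add: quotient_module_def FactRing_def)
  then show ?thesis
    unfolding A using E.fibre_bij E.fibre_zero E.fibre_add E.fibre_smult
    by (intro exI[of _ E.fibre] k_algebra_iso.intro k_algebra_coord k_algebra_iso_axioms.intro
        E.fibre_mult) (simp_all add: h.hom_mult)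
qed

end

theorem theorem4p3:
  fixes \<Gamma> :: "('v, 'e) pre_digraph"
  assumes "graph \<Gamma>" and "connected \<Gamma>" and "acyclic_graph \<Gamma>"
    and "card (verts \<Gamma>) > 1"
  shows "let K = (class_ring :: 'k::field ring);
             HH1 = hochschild_cohomology K (zigzag_algebra \<Gamma>) 1
         in vectorspace K HH1 \<and> vectorspace.fin_dim K HH1 \<and> vectorspace.dim K HH1 = 1"
proof -
  interpret graph \<Gamma> by fact
  let ?B = "coord_algebra :: ('k, ('v, 'e) zigzag_basis \<Rightarrow> 'k) module"
  obtain F where "k_algebra_iso ?B (zigzag_algebra \<Gamma>) F"
    using zigzag_algebra_iso connected_out_arcs[OF assms(2,4)] by blast
  then interpret iso: k_algebra_iso ?B "zigzag_algebra \<Gamma>" F .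
  obtain r where r: "r \<in> verts \<Gamma>" using assms(4) by fastforce
  obtain D where D: "is_derivation ?B D" "D (basis_vec (Loop r)) (Loop r) = 1"
    using outer_derivation_exists[OF r] by blast
  show ?thesis
    unfolding Let_def
    \<comment> \<open>The functional is the coefficient of l_r in D(l_r).\<close>
    by (rule iso.first_cohomology_dim_one_transport[of "basis_vec (Loop r)" "\<lambda>f. f (Loop r)" D])
      (use r D inner_derivation_iff[OF assms(2,3,4) r] in
        \<open>simp_all add: basis_vec_closed coord_algebra_simps(4,5)\<close>)
qed

end
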